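(* Let $n\ge1$, $0<p<1$, $\sigma\in J_n^+$, $\Lambda$ a continuous positive function, $\underline\vartheta,\overline\vartheta>0$, and $V\ge0$ continuous with $V(x,t)\ge\underline\vartheta\Lambda(t)|x|^\sigma$ for $|x|\ge1$, $t>0$, and $V(x,t)\le\overline\vartheta\Lambda(t)|x|^\sigma$ for $x\in\mathbb{R}^n$, $t>0$. Let $a\ge\frac{\sigma}{1-p}$ and $0\le u_0\in BC_a$ with $u_0\not\equiv0$. Let $\varepsilon_0>0$ be any constant such that $\int_{\{|x-y|\ge1\}}B(y)|x-y|^{\sigma+d}dy\ge\varepsilon_0|x|^{\sigma+d}$ for all $x$ and all $d\in[0,\frac{\sigma p}{1-p}]$. (1) If $0<p<\varepsilon_0\underline\vartheta/\overline\vartheta$, then the problem $\partial_tu-\Delta\partial_tu=\Delta u+Vu^p$, $u(\cdot,0)=u_0$, has a unique global s-solution $0\le u\in\mathcal{Z}_{\infty,a}$. (2) If moreover $V(x,t)=\Lambda(t)|x|^\sigma$, then for every $0<p<1$ this problem has a unique global s-solution $0\le u\in\mathcal{Z}_{\infty,a}$.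
   Context: $J_n^+=\{0\}\cup[1,\infty)$ if $n=1$, $J_n^+=[0,\infty)$ if $n\ge2$. $B=\mathcal{F}^{-1}((1+|\xi|^2)^{-1})$, $\mathcal{B}\varphi=B*\varphi=(I-\Delta)^{-1}\varphi$. $BC_a$: continuous functions with $|\varphi(x)|\le C|x|^a$ for large $|x|$, norm $\sup_x(R^2+|x|^2)^{-a/2}|\varphi(x)|$; $\mathcal{Z}_{T,a}=C([0,T);BC_a)$. A global s-solution is a function $u$ such that $\mu=e^tu\in\mathcal{Z}_{\infty,a}$ and $\mu(t)=u_0+\int_0^t\mathcal{B}\mu(\tau)d\tau+\int_0^te^{(1-p)\tau}\mathcal{B}[V\mu^p](\tau)d\tau$ for all $x\in\mathbb{R}^n$, $t\ge0$. *)

theory Defs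
  imports "HOL-Analysis.Analysis"
begin

text \<open>Power |r|^s with the mathematical convention r^0 = 1 (Isabelle has 0 powr 0 = 0).\<close>
definition pw :: "real \<Rightarrow> real \<Rightarrow> real" where
  "pw r s = (if s = 0 then 1 else r powr s)"

definition Jplus :: "nat \<Rightarrow> real set" where
  "Jplus n = (if n = 1 then {0} \<union> {1..} else {0..})"

text \<open>Bessel kernel B = F^{-1}((1+|xi|^2)^{-1}) on R^n (n = DIM('a)),
  via its standard integral representation
  B(x) = int_0^infty (4 pi t)^{-n/2} exp(-t - |x|^2/(4t)) dt.\<close>
definition besselB :: "'a::euclidean_space \<Rightarrow> real" where
  "besselB x = (\<integral>t\<in>{0<..}. (4 * pi * t) powr (- real DIM('a) / 2)
                   * exp (- t - (norm x)\<^sup>2 / (4 * t)) \<partial>lborel)"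

definition besselOp :: "('a::euclidean_space \<Rightarrow> real) \<Rightarrow> 'a \<Rightarrow> real" where
  "besselOp \<phi> x = (\<integral>y. besselB (x - y) * \<phi> y \<partial>lborel)"

definition BC :: "real \<Rightarrow> ('a::euclidean_space \<Rightarrow> real) set" where
  "BC a = {\<phi>. continuous_on UNIV \<phi> \<and>
             (\<exists>C R0. \<forall>x. norm x \<ge> R0 \<longrightarrow> \<bar>\<phi> x\<bar> \<le> C * pw (norm x) a)}"

text \<open>The norm of BC_a, sup_x (R^2+|x|^2)^{-a/2} |phi(x)|, with R = 1.\<close>
definition BCnorm :: "real \<Rightarrow> ('a::euclidean_space \<Rightarrow> real) \<Rightarrow> real" where
  "BCnorm a \<phi> = (SUP x. (1 + (norm x)\<^sup>2) powr (- a / 2) * \<bar>\<phi> x\<bar>)"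

definition Zinf :: "real \<Rightarrow> (real \<Rightarrow> 'a::euclidean_space \<Rightarrow> real) set" where
  "Zinf a = {\<mu>. (\<forall>t\<ge>0. \<mu> t \<in> BC a) \<and>
     (\<forall>t\<ge>0. \<forall>e>0. \<exists>d>0. \<forall>s\<ge>0. \<bar>s - t\<bar> < d \<longrightarrow>
          BCnorm a (\<lambda>x. \<mu> s x - \<mu> t x) < e)}"

text \<open>Global s-solution of u_t - Delta u_t = Delta u + V u^p, u(0) = u0:
  mu = e^t u lies in Z_{infty,a}, all integrals in the integral equation exist,
  and the integral equation holds for all x and t >= 0.\<close>
definition s_solution ::
  "('a::euclidean_space \<Rightarrow> real \<Rightarrow> real) \<Rightarrow> real \<Rightarrow> real \<Rightarrow> ('a \<Rightarrow> real)
     \<Rightarrow> (real \<Rightarrow> 'a \<Rightarrow> real) \<Rightarrow> bool" where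
  "s_solution V p a u0 u \<longleftrightarrow>
     (let \<mu> = (\<lambda>t x. exp t * u t x) in
       \<mu> \<in> Zinf a \<and>
       (\<forall>t\<ge>0. \<forall>x. integrable lborel (\<lambda>y. besselB (x - y) * \<mu> t y) \<and>
          integrable lborel (\<lambda>y. besselB (x - y) * (V y t * \<mu> t y powr p))) \<and>
       (\<forall>t\<ge>0. \<forall>x.
          (\<lambda>\<tau>. besselOp (\<mu> \<tau>) x) integrable_on {0..t} \<and>
          (\<lambda>\<tau>. exp ((1 - p) * \<tau>) * besselOp (\<lambda>y. V y \<tau> * \<mu> \<tau> y powr p) x)
             integrable_on {0..t} \<and>
          \<mu> t x = u0 x + integral {0..t} (\<lambda>\<tau>. besselOp (\<mu> \<tau>) x)
                 + integral {0..t} (\<lambda>\<tau>. exp ((1 - p) * \<tau>)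
                        * besselOp (\<lambda>y. V y \<tau> * \<mu> \<tau> y powr p) x)))"

definition unique_nonneg_global_s_solution ::
  "('a::euclidean_space \<Rightarrow> real \<Rightarrow> real) \<Rightarrow> real \<Rightarrow> real \<Rightarrow> ('a \<Rightarrow> real) \<Rightarrow> bool" where
  "unique_nonneg_global_s_solution V p a u0 \<longleftrightarrow>
     (\<exists>u. s_solution V p a u0 u \<and> u \<in> Zinf a \<and> (\<forall>t\<ge>0. \<forall>x. u t x \<ge> 0) \<and>
        (\<forall>v. s_solution V p a u0 v \<and> (\<forall>t\<ge>0. \<forall>x. v t x \<ge> 0) \<longrightarrow>
             (\<forall>t\<ge>0. \<forall>x. v t x = u t x)))"

end

(* Write jb x = sqrt (1 + |x|^2) and let mu = e^t u, so that
   mu(t) = u0 + int_0^t (B mu + e^((1-p)s) B[V mu^p]) ds.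

   Existence: the right-hand side is monotone in mu and sublinear, hence the Picard iterates from 0
   increase and stay below M e^(rho t) jb^a; their limit is a solution.

   Uniqueness: since u0 is nontrivial, bootstrapping the equation gives
   nu >= c t^(1/(1-p)) jb^(sigma/(1-p)) for every solution nu.  For a second solution mu and a large
   constant K, concavity of r^p yields
   V (mu^p - K nu^p) <= V (K nu)^(p-1) (mu - K nu)^+ <= (delta/t) (mu - K nu)^+
   with delta small, and a Gronwall argument with this singular coefficient gives mu <= K nu.
   Finally mu <= K nu implies mu <= K^p nu by the linear comparison principle for mu - K^p nu;
   iterating, K^(p^j) tends to 1. *)
theory Submission
  imports Defs "HOL-Probability.Distributions"
begin

section \<open>The Bessel kernel\<close>

text \<open>The obstacle is that r^p is not Lipschitz at 0: already y' = y^p can leave 0 at any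
  time, so uniqueness must use a positive lower bound. Its exponents 1/(1-p) and \<sigma>/(1-p) are
  the fixed points of \<gamma> -> 1 + p \<gamma> and d -> \<sigma> + p d. Raised to the power p - 1,
  the bound becomes a multiple of t^(-1) \<open>jb\<close> ^(-\<sigma>): the second factor cancels
  the growth of V, but the first is not integrable at 0, so an ordinary Gronwall argument does not
  close. It closes because mu - K nu is at most a multiple of t \<open>jb\<close> ^a, both solutions
  having the same initial value, and because a large K makes the coefficient of 1/t small. The
  condition on a says that \<sigma> + a p \<le> a, so that the source term maps the weight
  \<open>jb\<close> ^a into itself. About the Bessel kernel only three things are used, all read off
  the heat kernel representation: finite polynomial moments, an exponential lower bound, and Fatou's
  lemma. No asymptotics at the origin enter.\<close>

definition bessel_kern :: "real \<Rightarrow> 'a::euclidean_space \<Rightarrow> real" where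
  "bessel_kern t x = indicator {0<..} t *
     ((4 * pi * t) powr (- real DIM('a) / 2) * exp (- t - (norm x)\<^sup>2 / (4 * t)))"

text \<open>\<open>bessel_kern t\<close> is exp(-t) times the heat kernel at time t, extended by 0
  to t \<le> 0. In dimension at least 2 its t-integral diverges at the origin. With values in
  \<open>ennreal\<close> this is recorded as infinity, and Tonelli and Fatou apply without
  integrability conditions.\<close>

definition bessel_nn :: "'a::euclidean_space \<Rightarrow> ennreal" where
  "bessel_nn x = (\<integral>\<^sup>+t. ennreal (bessel_kern t x) \<partial>lborel)"

lemma bessel_kern_nonneg [simp]: "0 \<le> bessel_kern t x"
  by (simp add: bessel_kern_def)

lemma bessel_kern_measurable [measurable]:
  "(\<lambda>(t, x). bessel_kern t x) \<in> borel_measurable (borel \<Otimes>\<^sub>M borel)"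
  unfolding bessel_kern_def by measurable

lemma bessel_kern_continuous: "continuous_on UNIV (bessel_kern t)"
  unfolding bessel_kern_def by (cases "0 < t") (auto intro!: continuous_intros)

lemma bessel_nn_measurable [measurable]: "bessel_nn \<in> borel_measurable borel"
  unfolding bessel_nn_def by measurable

text \<open>Valid at the origin as well: a divergent Bochner integral has the default value 0, and
  so has \<open>enn2real\<close> at infinity.\<close>

lemma besselB_eq_enn2real: "besselB x = enn2real (bessel_nn x)"
proof -
  have "besselB x = (\<integral>t. bessel_kern t x \<partial>lborel)"
    unfolding besselB_def bessel_kern_def set_lebesgue_integral_def by simp
  also have "\<dots> = enn2real (bessel_nn x)"
    unfolding bessel_nn_def by (intro integral_eq_nn_integral) auto
  finally show ?thesis .
qed

lemma besselB_nonneg [simp]: "0 \<le> besselB x"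
  by (simp add: besselB_eq_enn2real)

lemma besselB_measurable [measurable]: "besselB \<in> borel_measurable borel"
  unfolding besselB_eq_enn2real[abs_def] by measurable

text \<open>The decay rate 8t, in place of the 4t of the heat kernel, is what remains after half of
  the Gaussian is spent on a weight. Each coordinate is then a normal density of variance 4t, while
  the prefactor is normalised for variance 2t; this mismatch costs sqrt 2 per coordinate.\<close>

lemma nn_integral_gaussian_euclidean:
  assumes t: "0 < t"
  shows "(\<integral>\<^sup>+x. ennreal ((4 * pi * t) powr (- real DIM('a) / 2) * exp (- (norm x)\<^sup>2 / (8 * t)))
            \<partial>(lborel :: 'a::euclidean_space measure)) = ennreal (sqrt 2 ^ DIM('a))"
proof -
  let ?f = "\<lambda>(b::'a) z. ennreal (sqrt 2 * normal_density 0 (2 * sqrt t) z)"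
  have f: "sqrt 2 * normal_density 0 (2 * sqrt t) z = (4 * pi * t) powr (-1/2) * exp (- z\<^sup>2 / (8 * t))" for z
    using t by (simp add: normal_density_def power_mult_distrib powr_minus powr_half_sqrt real_sqrt_mult
        field_simps flip: real_sqrt_mult)
  have "(\<Prod>b\<in>Basis. ?f b (x \<bullet> b)) =
      ennreal ((4 * pi * t) powr (- real DIM('a) / 2) * exp (- (norm x)\<^sup>2 / (8 * t)))" for x :: 'a
  proof -
    have "(norm x)\<^sup>2 = (\<Sum>b\<in>Basis. (x \<bullet> b)\<^sup>2)"
      by (subst power2_norm_eq_inner, subst euclidean_inner) (simp add: power2_eq_square)
    then have *: "exp (- (norm x)\<^sup>2 / (8 * t)) = (\<Prod>b\<in>Basis. exp (- (x \<bullet> b)\<^sup>2 / (8 * t)))"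
      by (simp add: exp_sum sum_divide_distrib flip: sum_negf)
    have "((4 * pi * t) powr (-1/2)) ^ DIM('a) = (4 * pi * t) powr (- real DIM('a) / 2)"
      using t by (simp add: powr_powr flip: powr_realpow)
    then show ?thesis
      unfolding f * by (subst prod_ennreal) (auto simp: prod.distrib)
  qed
  then have "(\<integral>\<^sup>+x. ennreal ((4 * pi * t) powr (- real DIM('a) / 2) * exp (- (norm x)\<^sup>2 / (8 * t)))
            \<partial>(lborel :: 'a measure)) = (\<integral>\<^sup>+x. (\<Prod>b\<in>Basis. ?f b (x \<bullet> b)) \<partial>lborel)"
    by simp
  also have "\<dots> = (\<Prod>b\<in>(Basis::'a set). (\<integral>\<^sup>+z. ?f b z \<partial>lborel))"
    by (intro nn_integral_lborel_prod) auto
  also have "(\<integral>\<^sup>+z. ennreal (sqrt 2 * normal_density 0 (2 * sqrt t) z) \<partial>lborel) = ennreal (sqrt 2)"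
    using t by (subst nn_integral_eq_integral) auto
  finally show ?thesis
    by (simp add: ennreal_power)
qed

lemma one_add_powr_le_exp:
  fixes d :: real
  obtains C where "0 < C" "\<And>r. 0 \<le> r \<Longrightarrow> (1 + r) powr d \<le> C * exp (r / 2)"
proof (cases "0 < d")
  case True
  have "(1 + r) powr d \<le> exp (1/2 - d + d * ln (2 * d)) * exp (r / 2)" if r: "0 \<le> r" for r
  proof -
    \<comment> \<open>The tangent to \<open>ln\<close> at 2d has slope 1/(2d); multiplied by d it
      gives exactly the rate 1/2.\<close>
    have "ln ((1 + r) / (2 * d)) \<le> (1 + r) / (2 * d) - 1"
      using True r by (intro ln_le_minus_one) auto
    then have "ln (1 + r) \<le> (1 + r) / (2 * d) - 1 + ln (2 * d)"
      using True r by (simp add: ln_div)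
    then have "d * ln (1 + r) \<le> d * ((1 + r) / (2 * d) - 1 + ln (2 * d))"
      using True by (intro mult_left_mono) auto
    also have "\<dots> = (1/2 - d + d * ln (2 * d)) + r / 2"
      using True by (simp add: field_simps)
    finally show ?thesis
      using r by (simp add: powr_def flip: exp_add)
  qed
  then show ?thesis by (intro that) auto
next
  case False
  have "(1 + r) powr d \<le> 1 * exp (r / 2)" if "0 \<le> r" for r
  proof -
    have "(1 + r) powr d \<le> (1 + r) powr 0"
      using False that by (intro powr_mono) auto
    also have "\<dots> \<le> exp (r / 2)" using that by simp
    finally show ?thesis by simp
  qed
  then show ?thesis by (intro that[of 1]) auto
qed

text \<open>A polynomial weight is at most a multiple of exp(|x|/2), and half of the exponent t +
  |x|^2/(4t) suffices to absorb that. The other half leaves an exponential density in t (its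
  normalisation causes the factor 2) times a Gaussian in x, so Tonelli finishes the proof.\<close>

lemma nn_integral_bessel_nn_weight_finite:
  "(\<integral>\<^sup>+x. bessel_nn x * ennreal ((1 + norm x) powr d) \<partial>(lborel :: 'a::euclidean_space measure)) < \<infinity>"
proof -
  obtain C where C: "0 < C" "\<And>r. 0 \<le> r \<Longrightarrow> (1 + r) powr d \<le> C * exp (r / 2)"
    by (rule one_add_powr_le_exp[of d]) blast
  let ?G = "\<lambda>t x::'a. (4 * pi * t) powr (- real DIM('a) / 2) * exp (- (norm x)\<^sup>2 / (8 * t))"
  have kern_le: "bessel_kern t x * (1 + norm x) powr d
      \<le> (2 * C) * exponential_density (1/2) t * ?G t x" if t: "0 < t" for t and x :: 'a
  proof -
    \<comment> \<open>The square vanishes at |x| = 2t, where t + |x|^2/(4t) attains its minimum in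
      t.\<close>
    have "0 \<le> (2 * t - norm x)\<^sup>2 / (8 * t)" using t by simp
    also have "\<dots> = t / 2 + (norm x)\<^sup>2 / (8 * t) - norm x / 2"
      using t by (simp add: power2_eq_square field_simps)
    finally have am_gm: "norm x / 2 \<le> t / 2 + (norm x)\<^sup>2 / (8 * t)" by simp
    have "(1 + norm x) powr d \<le> C * exp (norm x / 2)" by (intro C) simp
    also have "\<dots> \<le> C * exp (t / 2 + (norm x)\<^sup>2 / (8 * t))"
      using am_gm C by simp
    finally have "bessel_kern t x * (1 + norm x) powr d
        \<le> bessel_kern t x * (C * exp (t / 2 + (norm x)\<^sup>2 / (8 * t)))"
      by (intro mult_left_mono) auto
    also have "\<dots> = C * (4 * pi * t) powr (- real DIM('a) / 2) *
        (exp (- t - (norm x)\<^sup>2 / (4 * t)) * exp (t / 2 + (norm x)\<^sup>2 / (8 * t)))"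
      using t by (simp add: bessel_kern_def)
    also have "exp (- t - (norm x)\<^sup>2 / (4 * t)) * exp (t / 2 + (norm x)\<^sup>2 / (8 * t))
        = exp (- t / 2) * exp (- (norm x)\<^sup>2 / (8 * t))"
      unfolding exp_add[symmetric] using t by (simp add: field_simps)
    finally show ?thesis using t by (simp add: exponential_density_def mult_ac)
  qed
  have "(\<integral>\<^sup>+x. bessel_nn x * ennreal ((1 + norm x) powr d) \<partial>(lborel :: 'a measure))
     = (\<integral>\<^sup>+x. \<integral>\<^sup>+t. ennreal (bessel_kern t x * (1 + norm x) powr d) \<partial>lborel \<partial>(lborel :: 'a measure))"
    unfolding bessel_nn_def by (simp add: nn_integral_multc ennreal_mult'' flip: nn_integral_multc)
  also have "\<dots> = (\<integral>\<^sup>+t. \<integral>\<^sup>+x. ennreal (bessel_kern t x * (1 + norm x) powr d) \<partial>(lborel :: 'a measure) \<partial>lborel)"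
    by (intro lborel_pair.Fubini') measurable
  also have "\<dots> \<le> (\<integral>\<^sup>+t. ennreal (2 * C * sqrt 2 ^ DIM('a)) * ennreal (exponential_density (1/2) t) \<partial>lborel)"
  proof (intro nn_integral_mono)
    fix t :: real
    show "(\<integral>\<^sup>+x. ennreal (bessel_kern t x * (1 + norm x) powr d) \<partial>(lborel :: 'a measure))
        \<le> ennreal (2 * C * sqrt 2 ^ DIM('a)) * ennreal (exponential_density (1/2) t)"
    proof (cases "0 < t")
      case True
      have "(\<integral>\<^sup>+x. ennreal (bessel_kern t x * (1 + norm x) powr d) \<partial>(lborel :: 'a measure))
          \<le> (\<integral>\<^sup>+x. ennreal (2 * C * exponential_density (1/2) t) * ennreal (?G t x) \<partial>(lborel :: 'a measure))"
        using kern_le[OF True] C(1)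
        by (intro nn_integral_mono) (auto simp: exponential_density_def simp flip: ennreal_mult'')
      also have "\<dots> = ennreal (2 * C * exponential_density (1/2) t) * ennreal (sqrt 2 ^ DIM('a))"
        by (subst nn_integral_cmult) (simp_all only: nn_integral_gaussian_euclidean[OF True], measurable)
      finally show ?thesis
        using C(1) by (simp add: mult_ac exponential_density_def flip: ennreal_mult'')
    next
      case False
      then show ?thesis by (simp add: bessel_kern_def)
    qed
  qed
  also have "\<dots> = ennreal (2 * C * sqrt 2 ^ DIM('a))"
  proof -
    interpret prob_space "density lborel (exponential_density (1/2))"
      by (rule prob_space_exponential_density) simp
    have "(\<integral>\<^sup>+t. ennreal (exponential_density (1/2) t) \<partial>lborel) = 1"
      using emeasure_space_1 by (simp add: emeasure_density)
    then show ?thesis by (subst nn_integral_cmult) auto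
  qed
  finally show ?thesis by (simp add: order_le_less_trans)
qed

lemma AE_besselB_eq_bessel_nn:
  "AE x in (lborel :: 'a::euclidean_space measure). ennreal (besselB x) = bessel_nn x"
proof -
  have "AE x in (lborel :: 'a measure). bessel_nn x * ennreal ((1 + norm x) powr 0) \<noteq> \<infinity>"
    using nn_integral_bessel_nn_weight_finite[of 0, where 'a = 'a]
    by (intro nn_integral_noteq_infinite) auto
  then show ?thesis
    proof eventually_elim
    case (elim x)
    have "1 + norm x \<noteq> 0" using norm_ge_zero[of x] by linarith
    with elim show ?case by (simp add: besselB_eq_enn2real less_top)
  qed
qed

lemma integrable_besselB_weight:
  "integrable lborel (\<lambda>y::'a::euclidean_space. besselB y * (1 + norm y) powr d)"
proof (rule integrableI_nonneg)
  have "(\<integral>\<^sup>+y. ennreal (besselB y * (1 + norm y) powr d) \<partial>(lborel :: 'a measure))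
      = (\<integral>\<^sup>+x. bessel_nn x * ennreal ((1 + norm x) powr d) \<partial>(lborel :: 'a measure))"
    using AE_besselB_eq_bessel_nn[where 'a = 'a]
    by (intro nn_integral_cong_AE) (auto simp: ennreal_mult'')
  then show "(\<integral>\<^sup>+y. ennreal (besselB y * (1 + norm y) powr d) \<partial>(lborel :: 'a measure)) < \<infinity>"
    using nn_integral_bessel_nn_weight_finite[of d, where 'a = 'a] by simp
qed auto

text \<open>Only times in [1 + r, 2 + r] with r = |y| are kept. On this interval of length 1 the
  Gaussian exponent is at most r and the prefactor loses at most an exponential in r. The bound
  holds only almost everywhere because \<open>besselB\<close> takes the default value 0 where the
  t-integral diverges.\<close>

lemma besselB_ge_exp:
  obtains c K where "0 < c" "0 < K"
    "AE y in (lborel :: 'a::euclidean_space measure). c * exp (- K * norm y) \<le> besselB y"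
proof -
  let ?n = "real DIM('a)"
  let ?c = "(8 * pi) powr (- ?n / 2) * exp (-2)"
  let ?K = "?n / 2 + 2"
  have "ennreal (?c * exp (- ?K * norm y)) \<le> bessel_nn y" for y :: 'a
  proof -
    define r where "r = norm y"
    have r: "0 \<le> r" by (simp add: r_def)
    have "?c * exp (- ?K * r) * indicator {1 + r..2 + r} t \<le> bessel_kern t y" for t
    proof (cases "t \<in> {1 + r..2 + r}")
      case True
      then have t: "1 + r \<le> t" "t \<le> 2 + r" "0 < t" using r by auto
      have "4 * pi * t \<le> 8 * pi * exp r"
      proof -
        have "t \<le> 2 * (1 + r)" using t r by simp
        also have "\<dots> \<le> 2 * exp r" using exp_ge_add_one_self[of r] by (simp only: mult_le_cancel_left_pos zero_less_numeral)
        finally show ?thesis by simp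
      qed
      then have "(8 * pi * exp r) powr (- ?n / 2) \<le> (4 * pi * t) powr (- ?n / 2)"
        using t by (intro powr_mono2') auto
      moreover have "(8 * pi * exp r) powr (- ?n / 2) = (8 * pi) powr (- ?n / 2) * exp (- ?n / 2 * r)"
        by (simp add: powr_mult exp_powr_real mult.commute)
      moreover have "exp (-2 - 2 * r) \<le> exp (- t - r\<^sup>2 / (4 * t))"
      proof -
        have "r\<^sup>2 \<le> r * (4 * t)"
          unfolding power2_eq_square using t r by (intro mult_left_mono) auto
        then have "r\<^sup>2 / (4 * t) \<le> r" using t by (simp add: field_simps)
        then show ?thesis using t by simp
      qed
      ultimately have "(8 * pi) powr (- ?n / 2) * exp (- ?n / 2 * r) * exp (-2 - 2 * r)
          \<le> (4 * pi * t) powr (- ?n / 2) * exp (- t - r\<^sup>2 / (4 * t))"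
        by (intro mult_mono) auto
      moreover have "exp (- ?n / 2 * r) * exp (-2 - 2 * r) = exp (-2) * exp (- ?K * r)"
        unfolding exp_add[symmetric] by (simp add: algebra_simps)
      ultimately show ?thesis using t True by (simp add: bessel_kern_def r_def mult.assoc)
    qed (simp add: bessel_kern_def)
    then have "(\<integral>\<^sup>+t. ennreal (?c * exp (- ?K * r) * indicator {1 + r..2 + r} t) \<partial>lborel) \<le> bessel_nn y"
      unfolding bessel_nn_def by (intro nn_integral_mono ennreal_leI)
    also have "(\<integral>\<^sup>+t. ennreal (?c * exp (- ?K * r) * indicator {1 + r..2 + r} t) \<partial>lborel)
       = ennreal (?c * exp (- ?K * r)) * (\<integral>\<^sup>+t. indicator {1 + r..2 + r} t \<partial>lborel)"
      by (subst nn_integral_cmult[symmetric]) (auto simp: ennreal_mult'' ennreal_indicator)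
    finally show ?thesis by (simp add: r_def)
  qed
  with AE_besselB_eq_bessel_nn[where 'a = 'a]
  have "AE y in (lborel :: 'a measure). ?c * exp (- ?K * norm y) \<le> besselB y"
    by (auto elim!: eventually_mono simp flip: ennreal_le_iff)
  then show ?thesis by (intro that[of ?c ?K]) auto
qed

section \<open>The Bessel potential on weighted spaces\<close>

text \<open>The Japanese bracket.\<close>
definition jb :: "'a::euclidean_space \<Rightarrow> real" where
  "jb x = sqrt (1 + (norm x)\<^sup>2)"

lemma jb_ge_1: "1 \<le> jb x"
  by (simp add: jb_def)

lemma jb_pos [simp]: "0 < jb x"
  using jb_ge_1[of x] by linarith

lemma jb_nonneg [simp]: "0 \<le> jb x"
  using jb_ge_1[of x] by linarith

lemma jb_nonzero [simp]: "jb x \<noteq> 0"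
  using jb_ge_1[of x] by linarith

lemma norm_le_jb: "norm x \<le> jb x"
  by (simp add: jb_def real_le_rsqrt)

lemma jb_le_one_add_norm: "jb x \<le> 1 + norm x"
  by (auto simp: jb_def power2_eq_square algebra_simps intro!: real_le_lsqrt)

lemma jb_mono: "norm x \<le> norm y \<Longrightarrow> jb x \<le> jb y"
  by (simp add: jb_def)

lemma jb_continuous [continuous_intros]:
  "continuous_on S f \<Longrightarrow> continuous_on S (\<lambda>x. jb (f x))"
  unfolding jb_def by (intro continuous_intros)

lemma jb_measurable [measurable]: "jb \<in> borel_measurable borel"
  unfolding jb_def by measurable

text \<open>A Peetre-type inequality: it moves a weight from x - z to x at the price of a polynomial
  factor in z, which the kernel integrates.\<close>

lemma jb_diff_le: "jb (x - z) \<le> jb x * (1 + norm z)"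
proof -
  have "(norm (x - z))\<^sup>2 \<le> (norm x + norm z)\<^sup>2"
    by (intro power_mono norm_triangle_ineq4) simp
  moreover have "2 * norm z * norm x \<le> 2 * norm z * (1 + (norm x)\<^sup>2)"
    by (intro mult_left_mono) (use sum_power2_ge_zero[of "norm x - 1/2" 0] in
        \<open>simp_all add: power2_eq_square algebra_simps\<close>)
  moreover have "0 \<le> (norm x)\<^sup>2 * (norm z)\<^sup>2" by simp
  moreover have "(1 + (norm x)\<^sup>2) * (1 + norm z)\<^sup>2 = 1 + (norm x)\<^sup>2 + (norm z)\<^sup>2
      + 2 * norm z * (1 + (norm x)\<^sup>2) + (norm x)\<^sup>2 * (norm z)\<^sup>2"
    by (simp add: power2_eq_square algebra_simps)
  ultimately have "1 + (norm (x - z))\<^sup>2 \<le> (1 + (norm x)\<^sup>2) * (1 + norm z)\<^sup>2"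
    unfolding power2_sum[of "norm x"] by (simp only: mult_ac)
  then have "jb (x - z) \<le> sqrt ((1 + (norm x)\<^sup>2) * (1 + norm z)\<^sup>2)"
    unfolding jb_def by (rule real_sqrt_le_mono)
  then show ?thesis by (simp add: jb_def real_sqrt_mult)
qed

lemma jb_powr: "(1 + (norm x)\<^sup>2) powr (- a / 2) = jb x powr (- a)"
proof -
  have "0 < 1 + (norm x)\<^sup>2" by (simp add: add_pos_nonneg)
  then show ?thesis by (simp add: jb_def powr_powr flip: powr_half_sqrt)
qed

lemma weight_const_nonneg: "0 \<le> C * jb x powr a \<Longrightarrow> 0 \<le> C"
  using jb_pos[of x] by (simp add: zero_le_mult_iff)

lemma distr_lborel_reflect:
  "distr lborel borel (\<lambda>y. x - y) = (lborel :: 'a::euclidean_space measure)"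
  using lborel_affine[of "-1" x] by (simp add: density_1)

text \<open>After the reflection the kernel no longer contains x, so its singularity stays fixed
  when x varies.\<close>

lemma besselOp_reflect:
  assumes [measurable]: "\<phi> \<in> borel_measurable borel"
  shows "besselOp \<phi> x = (\<integral>z. besselB z * \<phi> (x - z) \<partial>lborel)"
    and "integrable lborel (\<lambda>y. besselB (x - y) * \<phi> y) \<longleftrightarrow> integrable lborel (\<lambda>z. besselB z * \<phi> (x - z))"
proof -
  have "(\<integral>z. besselB z * \<phi> (x - z) \<partial>distr lborel borel (\<lambda>y. x - y)) = besselOp \<phi> x"
    unfolding besselOp_def by (subst integral_distr) auto
  then show "besselOp \<phi> x = (\<integral>z. besselB z * \<phi> (x - z) \<partial>lborel)"
    by (simp add: distr_lborel_reflect)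
  have "integrable (distr lborel borel (\<lambda>y. x - y)) (\<lambda>z. besselB z * \<phi> (x - z)) \<longleftrightarrow>
      integrable lborel (\<lambda>y. besselB (x - y) * \<phi> y)"
    by (subst integrable_distr_eq) auto
  then show "integrable lborel (\<lambda>y. besselB (x - y) * \<phi> y) \<longleftrightarrow> integrable lborel (\<lambda>z. besselB z * \<phi> (x - z))"
    by (simp add: distr_lborel_reflect)
qed

lemma besselB_jb_le:
  assumes "0 \<le> a"
  shows "besselB z * jb (x - z) powr a \<le> jb x powr a * (besselB z * (1 + norm z) powr a)"
proof -
  have "jb (x - z) powr a \<le> (jb x * (1 + norm z)) powr a"
    using assms jb_diff_le by (intro powr_mono2) auto
  also have "\<dots> = jb x powr a * (1 + norm z) powr a"
    by (simp add: powr_mult)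
  finally show ?thesis by (simp add: mult_left_mono mult.left_commute)
qed

lemma integrable_bessel:
  assumes a: "0 \<le> a" and [measurable]: "\<phi> \<in> borel_measurable borel"
    and bound: "\<And>y. \<bar>\<phi> y\<bar> \<le> C * jb y powr a"
  shows "integrable lborel (\<lambda>y. besselB (x - y) * \<phi> y)"
  unfolding besselOp_reflect(2)[OF assms(2)]
proof (rule Bochner_Integration.integrable_bound)
  show "integrable lborel (\<lambda>z. C * jb x powr a * (besselB z * (1 + norm z) powr a))"
    by (intro integrable_mult_right integrable_besselB_weight)
  have "0 \<le> C * jb x powr a" using bound[of x] by linarith
  then have C: "0 \<le> C" by (rule weight_const_nonneg)
  have "norm (besselB z * \<phi> (x - z)) \<le> norm (C * jb x powr a * (besselB z * (1 + norm z) powr a))" for z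
  proof -
    have "norm (besselB z * \<phi> (x - z)) \<le> besselB z * (C * jb (x - z) powr a)"
      using bound[of "x - z"] by (simp add: abs_mult mult_left_mono)
    also have "\<dots> \<le> C * (jb x powr a * (besselB z * (1 + norm z) powr a))"
      using mult_left_mono[OF besselB_jb_le[OF a, of z x] C] by (simp add: mult_ac)
    finally show ?thesis using C by (simp add: mult_ac)
  qed
  then show "AE z in lborel. norm (besselB z * \<phi> (x - z))
      \<le> norm (C * jb x powr a * (besselB z * (1 + norm z) powr a))" by simp
qed measurable

lemma besselOp_mono:
  assumes "integrable lborel (\<lambda>y. besselB (x - y) * \<phi> y)" "integrable lborel (\<lambda>y. besselB (x - y) * \<psi> y)"
    and "\<And>y. \<phi> y \<le> \<psi> y"
  shows "besselOp \<phi> x \<le> besselOp \<psi> x"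
  unfolding besselOp_def using assms by (intro integral_mono) (auto intro: mult_left_mono)

lemma besselOp_nonneg: "(\<And>y. 0 \<le> \<phi> y) \<Longrightarrow> 0 \<le> besselOp \<phi> x"
  unfolding besselOp_def by (intro Bochner_Integration.integral_nonneg) auto

lemma besselOp_diff_cmult:
  assumes "integrable lborel (\<lambda>y. besselB (x - y) * \<phi> y)" "integrable lborel (\<lambda>y. besselB (x - y) * \<psi> y)"
  shows "besselOp (\<lambda>y. \<phi> y - k * \<psi> y) x = besselOp \<phi> x - k * besselOp \<psi> x"
    and "integrable lborel (\<lambda>y. besselB (x - y) * (\<phi> y - k * \<psi> y))"
proof -
  have *: "besselB (x - y) * (\<phi> y - k * \<psi> y) = besselB (x - y) * \<phi> y - k * (besselB (x - y) * \<psi> y)" for y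
    by (simp add: algebra_simps)
  show "besselOp (\<lambda>y. \<phi> y - k * \<psi> y) x = besselOp \<phi> x - k * besselOp \<psi> x"
    unfolding besselOp_def * using assms by simp
  show "integrable lborel (\<lambda>y. besselB (x - y) * (\<phi> y - k * \<psi> y))"
    unfolding * using assms by (intro Bochner_Integration.integrable_diff integrable_mult_right) auto
qed

text \<open>Deliberately one-sided: it is applied to differences such as mu - K nu, for which only
  an upper bound is available. The constant is a moment of the kernel, independent of \<phi>, C and
  x.\<close>

lemma besselOp_le_weight:
  fixes a :: real
  assumes a: "0 \<le> a"
  obtains K where "0 < K"
    "\<And>\<phi> C (x::'a::euclidean_space). 0 \<le> C \<Longrightarrow> integrable lborel (\<lambda>y. besselB (x - y) * \<phi> y) \<Longrightarrow>
        (\<And>y. \<phi> y \<le> C * jb y powr a) \<Longrightarrow> besselOp \<phi> x \<le> K * C * jb x powr a"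
proof -
  define K where "K = (\<integral>z. besselB z * (1 + norm z) powr a \<partial>(lborel :: 'a measure))"
  have K: "0 \<le> K" unfolding K_def by (intro Bochner_Integration.integral_nonneg) auto
  \<comment> \<open>Adding 1 makes the constant strictly positive, which later choices of growth
    rates rely on.\<close>
  have "besselOp \<phi> x \<le> (K + 1) * C * jb x powr a"
    if C: "0 \<le> C" and \<phi>: "integrable lborel (\<lambda>y. besselB (x - y) * \<phi> y)" "\<And>y. \<phi> y \<le> C * jb y powr a"
    for \<phi> C and x :: 'a
  proof -
    have int: "integrable lborel (\<lambda>y. besselB (x - y) * (C * jb y powr a))"
      using C by (intro integrable_bessel[OF a, of _ C]) auto
    have "besselOp \<phi> x \<le> besselOp (\<lambda>y. C * jb y powr a) x"
      by (intro besselOp_mono \<phi> int)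
    also have "\<dots> = (\<integral>z. besselB z * (C * jb (x - z) powr a) \<partial>lborel)"
      by (intro besselOp_reflect) measurable
    also have "\<dots> \<le> (\<integral>z. C * jb x powr a * (besselB z * (1 + norm z) powr a) \<partial>(lborel :: 'a measure))"
    proof (intro integral_mono)
      show "integrable lborel (\<lambda>z. besselB z * (C * jb (x - z) powr a))"
        using int besselOp_reflect(2)[of "\<lambda>y. C * jb y powr a" x] by simp
      show "besselB z * (C * jb (x - z) powr a) \<le> C * jb x powr a * (besselB z * (1 + norm z) powr a)" for z
        using mult_left_mono[OF besselB_jb_le[OF a, of z x] C] by (simp add: mult_ac)
    qed (intro integrable_mult_right integrable_besselB_weight)
    also have "\<dots> = K * C * jb x powr a" by (simp add: K_def)
    also have "\<dots> \<le> (K + 1) * C * jb x powr a" using C by (intro mult_right_mono) auto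
    finally show ?thesis .
  qed
  then show ?thesis using K by (intro that[of "K + 1"]) auto
qed

text \<open>On the ball |x - y| is at most |x - z| + r, so the exponential lower bound of the kernel
  becomes a constant there. The lemma spreads positivity from one ball to the whole space with
  controlled loss.\<close>

lemma besselOp_ge_ball:
  obtains c K where "0 < c" "0 < K"
    "\<And>\<phi> m r x (z::'a::euclidean_space). integrable lborel (\<lambda>y. besselB (x - y) * \<phi> y) \<Longrightarrow>
        (\<And>y. 0 \<le> \<phi> y) \<Longrightarrow> 0 \<le> m \<Longrightarrow> (\<And>y. y \<in> ball z r \<Longrightarrow> m \<le> \<phi> y) \<Longrightarrow>
        c * exp (- K * (norm (x - z) + r)) * m * measure lborel (ball z r) \<le> besselOp \<phi> x"
proof -
  obtain c K where c: "0 < c" and K: "0 < K"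
    and B: "AE y in (lborel :: 'a measure). c * exp (- K * norm y) \<le> besselB y"
    by (rule besselB_ge_exp)
  have "c * exp (- K * (norm (x - z) + r)) * m * measure lborel (ball z r) \<le> besselOp \<phi> x"
    if \<phi>: "integrable lborel (\<lambda>y. besselB (x - y) * \<phi> y)" "\<And>y. 0 \<le> \<phi> y"
      and m: "0 \<le> m" "\<And>y. y \<in> ball z r \<Longrightarrow> m \<le> \<phi> y" for \<phi> m r x and z :: 'a
  proof -
    have "AE y in distr lborel borel (\<lambda>y. x - y). c * exp (- K * norm y) \<le> besselB y"
      using B unfolding distr_lborel_reflect .
    then have B': "AE y in lborel. c * exp (- K * norm (x - y)) \<le> besselB (x - y)"
      by (subst (asm) AE_distr_iff) auto
    let ?l = "\<lambda>y. (c * exp (- K * (norm (x - z) + r)) * m) * indicator (ball z r) y :: real"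
    have "c * exp (- K * (norm (x - z) + r)) * m * measure lborel (ball z r) = (\<integral>y. ?l y \<partial>lborel)"
      by simp
    also have "\<dots> \<le> besselOp \<phi> x"
      unfolding besselOp_def
    proof (intro integral_mono_AE \<phi>)
      show "integrable lborel ?l"
        using emeasure_bounded_finite[OF bounded_ball, of z r]
        by (intro integrable_mult_right integrable_real_indicator) (auto simp: less_top)
      show "AE y in lborel. ?l y \<le> besselB (x - y) * \<phi> y"
        using B'
      proof eventually_elim
        case (elim y)
        show ?case
        proof (cases "y \<in> ball z r")
          case True
          then have "norm (x - y) \<le> norm (x - z) + r"
            using norm_triangle_ineq[of "x - z" "z - y"] by (simp add: dist_norm)
          then have "exp (- K * (norm (x - z) + r)) \<le> exp (- K * norm (x - y))"
            using K by simp
          then have "c * exp (- K * (norm (x - z) + r)) \<le> besselB (x - y)"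
            using elim c by (meson mult_left_mono less_imp_le order_trans)
          then show ?thesis
            using True m c by (auto intro!: mult_mono)
        qed (use \<phi>(2) in simp)
      qed
    qed
    finally show ?thesis .
  qed
  then show ?thesis using c K by (intro that[of c K]) auto
qed

section \<open>Convergence and continuity of Bessel potentials\<close>

lemma tendsto_besselOp:
  assumes a: "0 \<le> a" and [measurable]: "\<And>k. \<phi> k \<in> borel_measurable borel" "\<psi> \<in> borel_measurable borel"
    and bound: "\<And>k y. \<bar>\<phi> k y\<bar> \<le> C * jb y powr a" and lim: "\<And>y. (\<lambda>k. \<phi> k y) \<longlonglongrightarrow> \<psi> y"
  shows "(\<lambda>k. besselOp (\<phi> k) x) \<longlonglongrightarrow> besselOp \<psi> x"
  unfolding besselOp_def
proof (rule integral_dominated_convergence)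
  have "0 \<le> C * jb x powr a" using bound[of 0 x] by linarith
  then have C: "0 \<le> C" by (rule weight_const_nonneg)
  show "integrable lborel (\<lambda>y. besselB (x - y) * (C * jb y powr a))"
    using C by (intro integrable_bessel[OF a, of _ C]) auto
  show "AE y in lborel. (\<lambda>k. besselB (x - y) * \<phi> k y) \<longlonglongrightarrow> besselB (x - y) * \<psi> y"
    by (intro AE_I2 tendsto_intros lim)
  show "AE y in lborel. norm (besselB (x - y) * \<phi> k y) \<le> besselB (x - y) * (C * jb y powr a)" for k
    using bound by (auto simp: abs_mult intro!: mult_left_mono)
qed measurable

text \<open>For fixed t the heat kernel is continuous in x, so Fatou's lemma, applied first in t and
  then in y, replaces any continuity statement about the singular kernel itself.\<close>

lemma besselOp_lsc:
  assumes a: "0 \<le> a" and [measurable]: "\<phi> \<in> borel_measurable borel"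
    and nn: "\<And>y. 0 \<le> \<phi> y" and bound: "\<And>y. \<phi> y \<le> C * jb y powr a"
    and X: "X \<longlonglongrightarrow> x" and e: "e < besselOp \<phi> x"
  shows "\<forall>\<^sub>F k in sequentially. e < besselOp \<phi> (X k)"
proof -
  have eq: "ennreal (besselOp \<phi> z) = (\<integral>\<^sup>+y. bessel_nn (z - y) * ennreal (\<phi> y) \<partial>lborel)" for z
  proof -
    have "AE y in distr lborel borel (\<lambda>y. z - y). ennreal (besselB y) = bessel_nn y"
      using AE_besselB_eq_bessel_nn[where 'a = 'a] unfolding distr_lborel_reflect .
    then have B': "AE y in lborel. ennreal (besselB (z - y)) = bessel_nn (z - y)"
      by (subst (asm) AE_distr_iff) auto
    have "integrable lborel (\<lambda>y. besselB (z - y) * \<phi> y)"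
      using nn bound by (intro integrable_bessel[OF a, of _ C]) auto
    then have "ennreal (besselOp \<phi> z) = (\<integral>\<^sup>+y. ennreal (besselB (z - y) * \<phi> y) \<partial>lborel)"
      unfolding besselOp_def using nn by (intro nn_integral_eq_integral[symmetric]) auto
    also have "\<dots> = (\<integral>\<^sup>+y. bessel_nn (z - y) * ennreal (\<phi> y) \<partial>lborel)"
      using B' nn by (intro nn_integral_cong_AE) (auto simp: ennreal_mult'')
    finally show ?thesis .
  qed
  have scale: "bessel_nn (z - y) * ennreal (\<phi> y) = (\<integral>\<^sup>+t. ennreal (bessel_kern t (z - y) * \<phi> y) \<partial>lborel)" for z y
    unfolding bessel_nn_def using nn by (subst nn_integral_multc[symmetric]) (auto simp: ennreal_mult'')
  have fatou: "bessel_nn (x - y) * ennreal (\<phi> y) \<le> liminf (\<lambda>k. bessel_nn (X k - y) * ennreal (\<phi> y))" for y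
  proof -
    have "(\<lambda>k. ennreal (bessel_kern t (X k - y) * \<phi> y)) \<longlonglongrightarrow> ennreal (bessel_kern t (x - y) * \<phi> y)" for t
      using X by (intro tendsto_ennrealI tendsto_mult tendsto_const
          continuous_on_tendsto_compose[OF bessel_kern_continuous] tendsto_diff) auto
    then have "liminf (\<lambda>k. ennreal (bessel_kern t (X k - y) * \<phi> y)) = ennreal (bessel_kern t (x - y) * \<phi> y)" for t
      by (intro lim_imp_Liminf) auto
    then have "bessel_nn (x - y) * ennreal (\<phi> y)
        = (\<integral>\<^sup>+t. liminf (\<lambda>k. ennreal (bessel_kern t (X k - y) * \<phi> y)) \<partial>lborel)"
      by (simp add: scale)
    also have "\<dots> \<le> liminf (\<lambda>k. bessel_nn (X k - y) * ennreal (\<phi> y))"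
      unfolding scale by (intro nn_integral_liminf) measurable
    finally show ?thesis .
  qed
  have "ennreal (besselOp \<phi> x) \<le> (\<integral>\<^sup>+y. liminf (\<lambda>k. bessel_nn (X k - y) * ennreal (\<phi> y)) \<partial>lborel)"
    unfolding eq by (intro nn_integral_mono fatou)
  also have "\<dots> \<le> liminf (\<lambda>k. ennreal (besselOp \<phi> (X k)))"
    unfolding eq by (intro nn_integral_liminf) measurable
  finally have le: "ennreal (besselOp \<phi> x) \<le> liminf (\<lambda>k. ennreal (besselOp \<phi> (X k)))" .
  show ?thesis
  proof (cases "0 \<le> e")
    case True
    then have "ennreal e < ennreal (besselOp \<phi> x)" using e by (simp add: ennreal_lessI)
    with le have "\<forall>\<^sub>F k in sequentially. ennreal e < ennreal (besselOp \<phi> (X k))"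
      by (auto simp: le_Liminf_iff)
    then show ?thesis by eventually_elim (use True in \<open>simp add: ennreal_less_iff\<close>)
  next
    case False
    then show ?thesis
      using besselOp_nonneg[of \<phi>, OF nn] by (intro always_eventually) (metis not_le order_less_le_trans)
  qed
qed

text \<open>Both \<open>\<phi>\<close> and \<open>C * jb powr a - \<phi>\<close> have a lower semicontinuous Bessel potential by Fatou's lemma,
  while the potential of their continuous sum is continuous.\<close>
lemma besselOp_continuous:
  assumes a: "0 \<le> a" and [measurable]: "\<phi> \<in> borel_measurable borel"
    and nn: "\<And>y. 0 \<le> \<phi> y" and bound: "\<And>y. \<phi> y \<le> C * jb y powr a"
  shows "continuous_on UNIV (besselOp \<phi>)"
proof -
  let ?W = "\<lambda>y::'a. C * jb y powr a"
  let ?\<psi> = "\<lambda>y. ?W y - 1 * \<phi> y"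
  have "0 \<le> C * jb (0::'a) powr a" using nn[of 0] bound[of 0] by linarith
  then have C: "0 \<le> C" by (rule weight_const_nonneg)
  \<comment> \<open>After reflection X k occurs only in the continuous weight; boundedness of X
    together with \<open>besselB_jb_le\<close> yields a dominating function independent of
    k.\<close>
  have W: "(\<lambda>k. besselOp ?W (X k)) \<longlonglongrightarrow> besselOp ?W x" if X: "X \<longlonglongrightarrow> x" for X x
  proof -
    obtain R where R: "\<And>k. norm (X k) \<le> R"
      using convergent_imp_Bseq[of X] X by (auto simp: Bseq_def convergent_def)
    have "(\<lambda>k. \<integral>z. besselB z * ?W (X k - z) \<partial>lborel) \<longlonglongrightarrow> (\<integral>z. besselB z * ?W (x - z) \<partial>lborel)"
    proof (rule integral_dominated_convergence)
      show "integrable lborel (\<lambda>z::'a. C * (1 + R) powr a * (besselB z * (1 + norm z) powr a))"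
        by (intro integrable_mult_right integrable_besselB_weight)
      have "continuous_on UNIV (\<lambda>y. ?W (y - z))" for z
        by (intro continuous_intros) (simp add: less_imp_neq[OF jb_pos, symmetric])
      then show "AE z in lborel. (\<lambda>k. besselB z * ?W (X k - z)) \<longlonglongrightarrow> besselB z * ?W (x - z)"
        by (intro AE_I2 tendsto_mult tendsto_const continuous_on_tendsto_compose[OF _ X]) auto
      show "AE z in lborel. norm (besselB z * ?W (X k - z)) \<le> C * (1 + R) powr a * (besselB z * (1 + norm z) powr a)"
        for k
      proof (intro AE_I2)
        fix z :: 'a
        have "jb (X k) powr a \<le> (1 + R) powr a"
          using R[of k] jb_le_one_add_norm[of "X k"] a jb_pos[of "X k"] by (intro powr_mono2) auto
        then have "C * (jb (X k) powr a * (besselB z * (1 + norm z) powr a)) \<le>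
            C * ((1 + R) powr a * (besselB z * (1 + norm z) powr a))"
          using C by (intro mult_left_mono mult_right_mono) auto
        then show "norm (besselB z * ?W (X k - z)) \<le> C * (1 + R) powr a * (besselB z * (1 + norm z) powr a)"
          using mult_left_mono[OF besselB_jb_le[OF a, of z "X k"] C] C by (simp add: mult_ac)
      qed
    qed measurable
    then show ?thesis by (subst (1 2) besselOp_reflect) auto
  qed
  have iW: "integrable lborel (\<lambda>y. besselB (z - y) * ?W y)" for z
    using C by (intro integrable_bessel[OF a, of _ C]) auto
  have i\<phi>: "integrable lborel (\<lambda>y. besselB (z - y) * \<phi> y)" for z
    using nn bound by (intro integrable_bessel[OF a, of _ C]) auto
  have split: "besselOp ?\<psi> z = besselOp ?W z - besselOp \<phi> z" for z
    using besselOp_diff_cmult(1)[OF iW i\<phi>, where k = 1] by simp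
  show ?thesis
    unfolding continuous_on_sequentially comp_def
  proof (intro ballI allI impI)
    fix x X assume "(\<forall>n. X n \<in> UNIV) \<and> X \<longlonglongrightarrow> (x::'a)"
    then have X: "X \<longlonglongrightarrow> x" by simp
    show "(\<lambda>k. besselOp \<phi> (X k)) \<longlonglongrightarrow> besselOp \<phi> x"
    proof (rule order_tendstoI)
      show "\<forall>\<^sub>F k in sequentially. e < besselOp \<phi> (X k)" if "e < besselOp \<phi> x" for e
        using that by (intro besselOp_lsc[OF a _ nn bound X]) auto
      show "\<forall>\<^sub>F k in sequentially. besselOp \<phi> (X k) < e" if e: "besselOp \<phi> x < e" for e
      proof -
        \<comment> \<open>Half of the gap is spent on the lower semicontinuity of the complementary
          potential, half on the convergence of the potential of the weight.\<close>
        define h where "h = (e - besselOp \<phi> x) / 2"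
        have h: "0 < h" using e by (simp add: h_def)
        have "\<forall>\<^sub>F k in sequentially. besselOp ?\<psi> x - h < besselOp ?\<psi> (X k)"
          using h nn bound by (intro besselOp_lsc[OF a, of _ C]) (auto intro: X)
        moreover have "\<forall>\<^sub>F k in sequentially. besselOp ?W (X k) < besselOp ?W x + h"
          using h by (intro order_tendstoD(2)[OF W[OF X]]) simp
        ultimately show ?thesis
          by eventually_elim (unfold split h_def, simp add: field_simps)
      qed
    qed
  qed
qed

section \<open>The spaces \<open>BC\<close> and \<open>Zinf\<close> in terms of the weight
  \<open>jb\<close>\<close>

lemma pw_norm_le_jb: "0 \<le> a \<Longrightarrow> pw (norm x) a \<le> jb x powr a"
  using norm_le_jb[of x] by (auto simp: pw_def intro: powr_mono2)

lemma BC_bound: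
  assumes "\<phi> \<in> BC a" "0 \<le> a"
  obtains C where "\<And>x. \<bar>\<phi> x\<bar> \<le> C * jb x powr a"
proof -
  obtain C R where \<phi>: "continuous_on UNIV \<phi>" and R: "\<And>x. norm x \<ge> R \<Longrightarrow> \<bar>\<phi> x\<bar> \<le> C * pw (norm x) a"
    using assms(1) by (auto simp: BC_def)
  have "compact (\<phi> ` cball 0 R)"
    using \<phi> by (intro compact_continuous_image) (auto intro: continuous_on_subset)
  then obtain M where M: "\<And>x. x \<in> cball 0 R \<Longrightarrow> \<bar>\<phi> x\<bar> \<le> M"
    using compact_imp_bounded by (fastforce simp: bounded_iff)
  have "\<bar>\<phi> x\<bar> \<le> (\<bar>C\<bar> + \<bar>M\<bar>) * jb x powr a" for x
  proof (cases "norm x \<ge> R")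
    case True
    have "\<bar>\<phi> x\<bar> \<le> C * pw (norm x) a" by (intro R True)
    also have "\<dots> \<le> (\<bar>C\<bar> + \<bar>M\<bar>) * jb x powr a"
      using assms(2) by (intro mult_mono pw_norm_le_jb) (auto simp: pw_def)
    finally show ?thesis .
  next
    case False
    then have "\<bar>\<phi> x\<bar> \<le> (\<bar>C\<bar> + \<bar>M\<bar>) * 1" using M[of x] by simp
    also have "\<dots> \<le> (\<bar>C\<bar> + \<bar>M\<bar>) * jb x powr a"
      using assms(2) jb_ge_1[of x] by (intro mult_left_mono ge_one_powr_ge_zero) auto
    finally show ?thesis .
  qed
  then show ?thesis by (rule that)
qed

lemma BC_I:
  assumes "continuous_on UNIV \<phi>" "0 \<le> a" and bound: "\<And>x. \<bar>\<phi> x\<bar> \<le> C * jb x powr a"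
  shows "\<phi> \<in> BC a"
proof -
  have C: "0 \<le> C" using bound[of 0] abs_ge_zero order_trans by (intro weight_const_nonneg[of C 0 a]) blast
  have "\<bar>\<phi> x\<bar> \<le> (C * 2 powr a) * pw (norm x) a" if "1 \<le> norm x" for x
  proof -
    have "jb x \<le> 2 * norm x" using jb_le_one_add_norm[of x] that by linarith
    then have "jb x powr a \<le> (2 * norm x) powr a" using assms(2) by (intro powr_mono2) auto
    also have "\<dots> = 2 powr a * pw (norm x) a" using that by (auto simp: powr_mult pw_def)
    finally have "C * jb x powr a \<le> C * (2 powr a * pw (norm x) a)" using C by (intro mult_left_mono)
    then show ?thesis using bound[of x] by (simp add: mult.assoc)
  qed
  then show ?thesis using assms(1) by (auto simp: BC_def)
qed

text \<open>A real supremum is informative only over a set bounded above; membership in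
  \<open>BC a\<close> supplies that bound.\<close>

lemma BCnorm_bound:
  assumes "\<phi> \<in> BC a" "0 \<le> a"
  shows "\<bar>\<phi> x\<bar> \<le> BCnorm a \<phi> * jb x powr a"
proof -
  obtain C where C: "\<And>x. \<bar>\<phi> x\<bar> \<le> C * jb x powr a" by (rule BC_bound[OF assms]) blast
  have "jb y powr (- a) * \<bar>\<phi> y\<bar> \<le> C" for y
    using C[of y] jb_pos[of y] by (simp add: powr_minus divide_simps mult.commute)
  then have "bdd_above (range (\<lambda>y. jb y powr (- a) * \<bar>\<phi> y\<bar>))"
    by (intro bdd_aboveI[of _ C]) auto
  then have "jb x powr (- a) * \<bar>\<phi> x\<bar> \<le> BCnorm a \<phi>"
    unfolding BCnorm_def jb_powr by (intro cSUP_upper) auto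
  then show ?thesis using jb_pos[of x] by (simp add: powr_minus divide_simps mult.commute)
qed

lemma BCnorm_le:
  assumes "\<And>x. \<bar>\<phi> x\<bar> \<le> C * jb x powr a"
  shows "BCnorm a \<phi> \<le> C"
  unfolding BCnorm_def jb_powr
proof (intro cSUP_least)
  show "jb y powr (- a) * \<bar>\<phi> y\<bar> \<le> C" for y
    using assms[of y] jb_pos[of y] by (simp add: powr_minus divide_simps mult.commute)
qed auto

lemma BC_diff:
  assumes "\<phi> \<in> BC a" "\<psi> \<in> BC a" "0 \<le> a"
  shows "(\<lambda>x. \<phi> x - \<psi> x) \<in> BC a"
proof -
  obtain C where C: "\<And>x. \<bar>\<phi> x\<bar> \<le> C * jb x powr a" by (rule BC_bound[OF assms(1,3)]) blast
  obtain D where D: "\<And>x. \<bar>\<psi> x\<bar> \<le> D * jb x powr a" by (rule BC_bound[OF assms(2,3)]) blast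
  show ?thesis
  proof (rule BC_I)
    show "continuous_on UNIV (\<lambda>x. \<phi> x - \<psi> x)"
      using assms by (auto simp: BC_def intro: continuous_on_diff)
    show "\<bar>\<phi> x - \<psi> x\<bar> \<le> (C + D) * jb x powr a" for x
      using C[of x] D[of x] by (simp add: distrib_right)
  qed (rule assms)
qed

text \<open>The norm is continuous in time by the reverse triangle inequality, hence bounded on the
  compact interval {0..T}.\<close>

lemma Zinf_bound:
  assumes \<mu>: "\<mu> \<in> Zinf a" and a: "0 \<le> a"
  obtains M where "\<And>t x. 0 \<le> t \<Longrightarrow> t \<le> T \<Longrightarrow> \<bar>\<mu> t x\<bar> \<le> M * jb x powr a"
proof -
  have BC: "\<mu> t \<in> BC a" if "0 \<le> t" for t using \<mu> that by (simp add: Zinf_def)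
  let ?f = "\<lambda>t. BCnorm a (\<mu> t)"
  \<comment> \<open>The pair r, q allows both orders of subtraction, so that both halves of the
    reverse triangle inequality can use the one difference that the definition of
    \<open>Zinf\<close> controls.\<close>
  have tri: "?f s \<le> ?f t + BCnorm a (\<lambda>x. \<mu> r x - \<mu> q x)"
    if "0 \<le> s" "0 \<le> t" "r = s \<and> q = t \<or> r = t \<and> q = s" for s t r q
  proof (rule BCnorm_le)
    fix x
    have "(\<lambda>x. \<mu> r x - \<mu> q x) \<in> BC a" using that by (auto intro!: BC_diff BC a)
    from BCnorm_bound[OF this a, of x] BCnorm_bound[OF BC a, of t x] that
    show "\<bar>\<mu> s x\<bar> \<le> (?f t + BCnorm a (\<lambda>x. \<mu> r x - \<mu> q x)) * jb x powr a"
      unfolding distrib_right by auto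
  qed
  have "continuous_on {0..T} ?f"
    unfolding continuous_on_iff
  proof (intro ballI allI impI)
    fix t e :: real assume t: "t \<in> {0..T}" and e: "0 < e"
    then obtain d where d: "0 < d" "\<And>s. 0 \<le> s \<Longrightarrow> \<bar>s - t\<bar> < d \<Longrightarrow> BCnorm a (\<lambda>x. \<mu> s x - \<mu> t x) < e"
      using \<mu> unfolding Zinf_def by (auto, meson)
    show "\<exists>d>0. \<forall>s\<in>{0..T}. dist s t < d \<longrightarrow> dist (?f s) (?f t) < e"
    proof (intro exI conjI ballI impI)
      fix s assume s: "s \<in> {0..T}" "dist s t < d"
      then show "dist (?f s) (?f t) < e"
        using d(2)[of s] tri[of s t s t] tri[of t s s t] t by (auto simp: dist_real_def)
    qed (rule d)
  qed
  then have "bounded (?f ` {0..T})"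
    by (intro compact_imp_bounded compact_continuous_image) auto
  then obtain M where M: "\<And>t. t \<in> {0..T} \<Longrightarrow> \<bar>?f t\<bar> \<le> M" by (auto simp: bounded_iff) (meson atLeastAtMost_iff)
  have "\<bar>\<mu> t x\<bar> \<le> M * jb x powr a" if "0 \<le> t" "t \<le> T" for t x
  proof -
    have "\<bar>\<mu> t x\<bar> \<le> ?f t * jb x powr a" using that by (intro BCnorm_bound BC a)
    also have "\<dots> \<le> M * jb x powr a" using M[of t] that by (intro mult_right_mono) auto
    finally show ?thesis .
  qed
  then show ?thesis by (rule that)
qed

lemma Zinf_I:
  assumes BC: "\<And>t. 0 \<le> t \<Longrightarrow> \<mu> t \<in> BC a"
    and Lip: "\<And>T. 0 \<le> T \<Longrightarrow> \<exists>L. \<forall>s\<in>{0..T}. \<forall>t\<in>{0..T}. \<forall>x. \<bar>\<mu> s x - \<mu> t x\<bar> \<le> L * \<bar>s - t\<bar> * jb x powr a"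
  shows "\<mu> \<in> Zinf a"
  unfolding Zinf_def
proof (intro CollectI conjI allI impI BC)
  fix t e :: real assume t: "0 \<le> t" and e: "0 < e"
  from Lip[of "t + 1"] t obtain L where
    L: "\<And>s r x. s \<in> {0..t + 1} \<Longrightarrow> r \<in> {0..t + 1} \<Longrightarrow> \<bar>\<mu> s x - \<mu> r x\<bar> \<le> L * \<bar>s - r\<bar> * jb x powr a"
    by (metis add_nonneg_nonneg zero_le_one)
  show "\<exists>d>0. \<forall>s\<ge>0. \<bar>s - t\<bar> < d \<longrightarrow> BCnorm a (\<lambda>x. \<mu> s x - \<mu> t x) < e"
  proof (intro exI conjI allI impI)
    \<comment> \<open>The bound 1 keeps s inside the interval {0..t + 1} on which L is valid;
      \<bar>L\<bar> + 1 avoids dividing by a nonpositive number.\<close>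
    show "0 < min 1 (e / (\<bar>L\<bar> + 1))" using e by simp
    fix s assume s: "0 \<le> s" "\<bar>s - t\<bar> < min 1 (e / (\<bar>L\<bar> + 1))"
    have "BCnorm a (\<lambda>x. \<mu> s x - \<mu> t x) \<le> L * \<bar>s - t\<bar>"
      using s t by (intro BCnorm_le L) auto
    also have "\<dots> \<le> (\<bar>L\<bar> + 1) * \<bar>s - t\<bar>" by (intro mult_right_mono) auto
    also have "\<dots> < e" using s by (simp add: field_simps)
    finally show "BCnorm a (\<lambda>x. \<mu> s x - \<mu> t x) < e" .
  qed
qed

text \<open>A substitute for Gronwall's inequality: for a suitable weight w, a linear integral
  inequality halves every admissible bound, so E is at most N w / 2^k for all k. No supremum over x
  has to be formed or shown measurable in time, and w may vanish at t = 0.\<close>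

lemma nonpos_of_halving:
  fixes E w :: "'b \<Rightarrow> real"
  assumes base: "\<And>z. z \<in> S \<Longrightarrow> E z \<le> N * w z" and N: "0 \<le> N"
    and step: "\<And>M. 0 \<le> M \<Longrightarrow> (\<And>z. z \<in> S \<Longrightarrow> E z \<le> M * w z) \<Longrightarrow> (\<And>z. z \<in> S \<Longrightarrow> E z \<le> M / 2 * w z)"
    and z: "z \<in> S"
  shows "E z \<le> 0"
proof -
  have "\<forall>z\<in>S. E z \<le> N / 2 ^ k * w z" for k
  proof (induction k)
    case 0
    then show ?case using base by simp
  next
    case (Suc k)
    show ?case
    proof
      fix z assume "z \<in> S"
      then show "E z \<le> N / 2 ^ Suc k * w z"
        using step[of "N / 2 ^ k" z] Suc N by (simp add: mult.commute)
    qed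
  qed
  then have "E z \<le> N * w z * (1 / 2) ^ k" for k
    using z by (simp add: power_one_over field_simps)
  moreover have "(\<lambda>k. N * w z * (1 / 2) ^ k) \<longlonglongrightarrow> N * w z * 0"
    by (intro tendsto_intros LIMSEQ_realpow_zero) auto
  ultimately show ?thesis by (intro LIMSEQ_le_const) auto
qed

text \<open>Where m exceeds K n, write m^p = m^(p-1) m and use that the exponent p - 1 is negative;
  elsewhere monotonicity suffices. The factor K, instead of K^p, in front of n^p is allowed since K
  \<ge> 1; it makes the left side match the source of mu - K nu.\<close>

lemma powr_diff_le:
  fixes m n K p :: real
  assumes p: "0 < p" "p < 1" and m: "0 \<le> m" and n: "0 < n" and K: "1 \<le> K"
  shows "m powr p - K * n powr p \<le> (K * n) powr (p - 1) * max (m - K * n) 0"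
proof -
  have "(K * n) powr p \<le> K * n powr p"
  proof -
    have "K powr p \<le> K powr 1" using p K by (intro powr_mono) auto
    then show ?thesis using K n by (simp add: powr_mult mult_right_mono)
  qed
  moreover have "m powr p \<le> (K * n) powr p + (K * n) powr (p - 1) * max (m - K * n) 0"
  proof (cases "m \<le> K * n")
    case True
    then show ?thesis using m p by (simp add: powr_mono2)
  next
    case False
    have Kn: "0 < K * n" using K n by simp
    have split: "z powr p = z powr (p - 1) * z" if "0 < z" for z :: real
      using that powr_add[of z "p - 1" 1] by simp
    have "m powr p = m powr (p - 1) * m" using False Kn by (intro split) simp
    also have "\<dots> \<le> (K * n) powr (p - 1) * m"
      using False Kn p m by (intro mult_right_mono powr_mono2') auto
    also have "\<dots> = (K * n) powr p + (K * n) powr (p - 1) * (m - K * n)"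
      unfolding split[OF Kn] by (simp add: algebra_simps)
    finally show ?thesis using False by simp
  qed
  ultimately show ?thesis by linarith
qed

lemma has_integral_exp_real:
  fixes \<rho> t :: real
  assumes "0 < \<rho>" "0 \<le> t"
  shows "((\<lambda>s. exp (\<rho> * s)) has_integral (exp (\<rho> * t) - 1) / \<rho>) {0..t}"
proof -
  have "((\<lambda>s. exp (\<rho> * s)) has_integral exp (\<rho> * t) / \<rho> - exp (\<rho> * 0) / \<rho>) {0..t}"
    using assms by (intro fundamental_theorem_of_calculus)
      (auto intro!: derivative_eq_intros simp: has_real_derivative_iff_has_vector_derivative[symmetric])
  then show ?thesis by (simp add: diff_divide_distrib)
qed

section \<open>Uniqueness\<close>

text \<open>The bounds on V are local in time with constants depending on T. The upper one uses
  \<open>jb\<close>, which removes the special case of \<open>pw\<close> at the origin; the lower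
  one is restricted to |x| \<ge> 1, where \<open>pw\<close> and \<open>powr\<close> agree.\<close>

locale sublinear_problem =
  fixes V :: "'a::euclidean_space \<Rightarrow> real \<Rightarrow> real" and p \<sigma> a :: real and u0 :: "'a \<Rightarrow> real"
  assumes p: "0 < p" "p < 1"
    and sigma: "0 \<le> \<sigma>"
    and a: "\<sigma> / (1 - p) \<le> a"
    and Vcont: "continuous_on (UNIV \<times> {0..}) (\<lambda>(x, t). V x t)"
    and Vnonneg: "0 \<le> t \<Longrightarrow> 0 \<le> V x t"
    and Vupper: "\<exists>L>0. \<forall>t x. 0 \<le> t \<and> t \<le> T \<longrightarrow> V x t \<le> L * jb x powr \<sigma>"
    and Vlower: "\<exists>l>0. \<forall>t x. 0 < t \<and> t \<le> T \<and> 1 \<le> norm x \<longrightarrow> l * norm x powr \<sigma> \<le> V x t"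
    and u0: "u0 \<in> BC a" "0 \<le> u0 x" "u0 \<noteq> (\<lambda>x. 0)"
begin

lemma a_nonneg: "0 \<le> a"
proof -
  have "0 \<le> \<sigma> / (1 - p)" using sigma p by simp
  then show ?thesis using a by simp
qed

text \<open>The hypothesis on a in working form: a V of growth \<sigma> times the p-th power of a
  function of growth a again has growth at most a.\<close>

lemma exponent_le: "\<sigma> + a * p \<le> a"
  using a p by (simp add: field_simps)

definition source :: "(real \<Rightarrow> 'a \<Rightarrow> real) \<Rightarrow> real \<Rightarrow> 'a \<Rightarrow> real" where
  "source \<mu> t y = V y t * \<mu> t y powr p"

text \<open>The time derivative of mu that the integral equation prescribes; merging the two
  integrands lets each comparison deal with one time integral.\<close>

definition rhs :: "(real \<Rightarrow> 'a \<Rightarrow> real) \<Rightarrow> real \<Rightarrow> 'a \<Rightarrow> real" where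
  "rhs \<mu> t x = besselOp (\<mu> t) x + exp ((1 - p) * t) * besselOp (source \<mu> t) x"

definition sol :: "(real \<Rightarrow> 'a \<Rightarrow> real) \<Rightarrow> bool" where
  "sol \<mu> \<longleftrightarrow> \<mu> \<in> Zinf a \<and> (\<forall>t\<ge>0. \<forall>x. 0 \<le> \<mu> t x \<and>
     integrable lborel (\<lambda>y. besselB (x - y) * \<mu> t y) \<and>
     integrable lborel (\<lambda>y. besselB (x - y) * source \<mu> t y) \<and>
     (\<lambda>\<tau>. besselOp (\<mu> \<tau>) x) integrable_on {0..t} \<and>
     (\<lambda>\<tau>. exp ((1 - p) * \<tau>) * besselOp (source \<mu> \<tau>) x) integrable_on {0..t} \<and>
     \<mu> t x = u0 x + integral {0..t} (\<lambda>\<tau>. besselOp (\<mu> \<tau>) x)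
        + integral {0..t} (\<lambda>\<tau>. exp ((1 - p) * \<tau>) * besselOp (source \<mu> \<tau>) x))"

lemma s_solution_iff_sol:
  "s_solution V p a u0 u \<and> (\<forall>t\<ge>0. \<forall>x. 0 \<le> u t x) \<longleftrightarrow> sol (\<lambda>t x. exp t * u t x)"
  unfolding s_solution_def sol_def Let_def source_def zero_le_mult_iff by auto

lemma source_le:
  assumes "V y t \<le> L * jb y powr \<sigma>" "0 \<le> \<mu> t y" "\<mu> t y \<le> M * jb y powr a" "0 \<le> t" "0 \<le> L" "0 \<le> M"
  shows "source \<mu> t y \<le> L * M powr p * jb y powr a"
proof -
  have "\<mu> t y powr p \<le> (M * jb y powr a) powr p"
    using assms p by (intro powr_mono2) auto
  also have "\<dots> = M powr p * jb y powr (a * p)"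
    using assms by (simp add: powr_mult powr_powr)
  finally have "source \<mu> t y \<le> (L * jb y powr \<sigma>) * (M powr p * jb y powr (a * p))"
    unfolding source_def using assms by (intro mult_mono) auto
  also have "\<dots> = L * M powr p * jb y powr (\<sigma> + a * p)"
    by (simp add: powr_add)
  also have "\<dots> \<le> L * M powr p * jb y powr a"
    using assms exponent_le jb_ge_1 by (intro mult_left_mono powr_mono) auto
  finally show ?thesis .
qed

lemma source_nonneg: "0 \<le> t \<Longrightarrow> 0 \<le> source \<mu> t y"
  by (simp add: source_def Vnonneg)

lemma rhs_nonneg: "0 \<le> t \<Longrightarrow> (\<And>y. 0 \<le> \<mu> t y) \<Longrightarrow> 0 \<le> rhs \<mu> t x"
  by (simp add: rhs_def besselOp_nonneg source_nonneg)

section \<open>A fixed nonnegative solution and its lower bound\<close>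

context
  fixes \<mu> assumes sol: "sol \<mu>"
begin

lemma sol_nonneg: "0 \<le> t \<Longrightarrow> 0 \<le> \<mu> t x"
  using sol unfolding sol_def by blast

lemma sol_Zinf: "\<mu> \<in> Zinf a"
  using sol unfolding sol_def by blast

lemma sol_integrable: "0 \<le> t \<Longrightarrow> integrable lborel (\<lambda>y. besselB (x - y) * \<mu> t y)"
  and sol_source_integrable: "0 \<le> t \<Longrightarrow> integrable lborel (\<lambda>y. besselB (x - y) * source \<mu> t y)"
  using sol unfolding sol_def by blast+

lemma sol_rhs:
  assumes "0 \<le> t"
  shows "(\<lambda>\<tau>. rhs \<mu> \<tau> x) integrable_on {0..t}"
    and "\<mu> t x = u0 x + integral {0..t} (\<lambda>\<tau>. rhs \<mu> \<tau> x)"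
proof -
  have 1: "(\<lambda>\<tau>. besselOp (\<mu> \<tau>) x) integrable_on {0..t}"
    and 2: "(\<lambda>\<tau>. exp ((1 - p) * \<tau>) * besselOp (source \<mu> \<tau>) x) integrable_on {0..t}"
    and 3: "\<mu> t x = u0 x + integral {0..t} (\<lambda>\<tau>. besselOp (\<mu> \<tau>) x)
                 + integral {0..t} (\<lambda>\<tau>. exp ((1 - p) * \<tau>) * besselOp (source \<mu> \<tau>) x)"
    using sol assms unfolding sol_def by blast+
  show "(\<lambda>\<tau>. rhs \<mu> \<tau> x) integrable_on {0..t}"
    unfolding rhs_def by (intro Henstock_Kurzweil_Integration.integrable_add 1 2)
  show "\<mu> t x = u0 x + integral {0..t} (\<lambda>\<tau>. rhs \<mu> \<tau> x)"
    unfolding rhs_def 3 by (subst Henstock_Kurzweil_Integration.integral_add[OF 1 2]) simp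
qed

lemma sol_ge:
  assumes "0 \<le> t" "(f has_integral i) {0..t}" "\<And>s. 0 \<le> s \<Longrightarrow> s \<le> t \<Longrightarrow> f s \<le> rhs \<mu> s x"
  shows "u0 x + i \<le> \<mu> t x"
proof -
  have "i = integral {0..t} f" using assms by (simp add: integral_unique)
  also have "\<dots> \<le> integral {0..t} (\<lambda>\<tau>. rhs \<mu> \<tau> x)"
    using assms sol_rhs by (intro Henstock_Kurzweil_Integration.integral_le) auto
  finally show ?thesis using sol_rhs(2)[OF assms(1)] by simp
qed

lemma sol_ge_u0: "0 \<le> t \<Longrightarrow> u0 x \<le> \<mu> t x"
  using sol_ge[of t "\<lambda>_. 0" 0 x] rhs_nonneg[of _ \<mu> x] sol_nonneg by simp

text \<open>Starting from \<open>t exp (-K|x|)\<close>, one application of the integral equation raises the exponent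
  \<open>\<gamma>\<close> of \<open>t\<close> to \<open>1 + p \<gamma>\<close>, the exponent \<open>d\<close> of the weight to \<open>\<sigma> + p d\<close> and multiplies the exponential
  rate by \<open>p\<close>; the constant \<open>c\<close> survives because it satisfies \<open>c \<le> \<kappa> (1 - p) c powr p\<close>.\<close>
lemma sol_lower:
  fixes T :: real
  obtains c where "0 < c"
    "\<And>t x. 0 \<le> t \<Longrightarrow> t \<le> T \<Longrightarrow> c * t powr (1 / (1 - p)) * jb x powr (\<sigma> / (1 - p)) \<le> \<mu> t x"
proof -
  obtain b K where b: "0 < b" and K: "0 < K" and ball:
    "\<And>\<phi> m r x (z::'a). integrable lborel (\<lambda>y. besselB (x - y) * \<phi> y) \<Longrightarrow>
        (\<And>y. 0 \<le> \<phi> y) \<Longrightarrow> 0 \<le> m \<Longrightarrow> (\<And>y. y \<in> ball z r \<Longrightarrow> m \<le> \<phi> y) \<Longrightarrow>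
        b * exp (- K * (norm (x - z) + r)) * m * measure lborel (ball z r) \<le> besselOp \<phi> x"
    by (rule besselOp_ge_ball) blast
  have vol: "0 < measure lborel (ball z r)" if "0 < r" for z :: 'a and r
    using that by (simp add: content_ball)
  have vol_eq: "measure lborel (ball z (1/2)) = measure lborel (ball (0::'a) (1/2))" for z :: 'a
    by (simp add: content_ball)

  \<comment> \<open>The linear term alone suffices here: u0 exceeds half of its value at some x0 on
    a ball, every solution stays above u0, and the kernel spreads this with rate K.\<close>
  obtain c0 where c0: "0 < c0" and start: "\<And>t x. 0 \<le> t \<Longrightarrow> c0 * t * exp (- K * norm x) \<le> \<mu> t x"
  proof -
    obtain x0 where x0: "0 < u0 x0" using u0(2,3) by (metis order_le_less)
    have "isCont u0 x0" using u0(1) by (simp add: BC_def continuous_on_eq_continuous_at)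
    then have "\<forall>\<^sub>F y in nhds x0. u0 x0 / 2 < u0 y"
      using x0 by (intro order_tendstoD) (auto simp: continuous_within tendsto_at_iff_tendsto_nhds)
    then obtain r where r: "0 < r" "\<And>y. dist y x0 < r \<Longrightarrow> u0 x0 / 2 < u0 y"
      by (auto simp: eventually_nhds_metric)
    define c0 where "c0 = b * exp (- K * (norm x0 + r)) * (u0 x0 / 2) * measure lborel (ball x0 r)"
    have "0 < c0" unfolding c0_def using b x0 vol[OF r(1)] by simp
    moreover have "c0 * t * exp (- K * norm x) \<le> \<mu> t x" if t: "0 \<le> t" for t x
    proof -
      have "c0 * exp (- K * norm x) \<le> rhs \<mu> s x" if s: "0 \<le> s" for s
      proof -
        have "exp (- K * (norm x0 + r)) * exp (- K * norm x) \<le> exp (- K * (norm (x - x0) + r))"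
          unfolding exp_add[symmetric] using K mult_left_mono[OF norm_triangle_ineq4[of x x0], of K]
          by (simp add: algebra_simps)
        then have "b * (u0 x0 / 2) * measure lborel (ball x0 r) * (exp (- K * (norm x0 + r)) * exp (- K * norm x))
            \<le> b * (u0 x0 / 2) * measure lborel (ball x0 r) * exp (- K * (norm (x - x0) + r))"
          using b x0 by (intro mult_left_mono) auto
        then have "c0 * exp (- K * norm x) \<le>
            b * exp (- K * (norm (x - x0) + r)) * (u0 x0 / 2) * measure lborel (ball x0 r)"
          unfolding c0_def by (simp only: mult_ac)
        also have "\<dots> \<le> besselOp (\<mu> s) x"
        proof (rule ball)
          show "u0 x0 / 2 \<le> \<mu> s y" if "y \<in> ball x0 r" for y
            using r(2)[of y] sol_ge_u0[OF s, of y] that by (simp add: dist_commute)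
        qed (use s x0 in \<open>auto intro: sol_integrable sol_nonneg\<close>)
        also have "\<dots> \<le> rhs \<mu> s x"
          unfolding rhs_def using s by (simp add: besselOp_nonneg source_nonneg)
        finally show ?thesis .
      qed
      moreover have "((\<lambda>s. c0 * exp (- K * norm x)) has_integral t * (c0 * exp (- K * norm x))) {0..t}"
        using has_integral_const_real[of "c0 * exp (- K * norm x)" 0 t] t by simp
      ultimately have "u0 x + t * (c0 * exp (- K * norm x)) \<le> \<mu> t x"
        by (intro sol_ge t)
      then show ?thesis using u0(2)[of x] by (simp add: mult_ac)
    qed
    ultimately show ?thesis by (rule that)
  qed

  obtain l where l: "0 < l" and Vl: "\<And>t x. 0 < t \<Longrightarrow> t \<le> T \<Longrightarrow> 1 \<le> norm x \<Longrightarrow> l * norm x powr \<sigma> \<le> V x t"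
    using Vlower[of T] by blast
  \<comment> \<open>All losses of one iteration: b exp(-2K) from the kernel at distance at most 3/2
    + 1/2, l from V, a second exp(-2K) because |y| may reach |x| + 2, and the volume of a ball of
    radius 1/2.\<close>
  define \<kappa> where "\<kappa> = b * exp (- 2 * K) * (l * exp (- 2 * K)) * measure lborel (ball (0::'a) (1/2))"
  have \<kappa>: "0 < \<kappa>" unfolding \<kappa>_def using b l vol[of "1/2" "0::'a"] by simp
  \<comment> \<open>c \<le> c0 serves the start of the induction; the second entry is the positive
    solution of c = \<kappa> (1 - p) c^p.\<close>
  define c where "c = min c0 ((\<kappa> * (1 - p)) powr (1 / (1 - p)))"
  have c: "0 < c" "c \<le> c0" using c0 \<kappa> p by (auto simp: c_def)
  have c_fix: "c \<le> \<kappa> * (1 - p) * c powr p"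
  proof -
    have "c powr (1 - p) \<le> ((\<kappa> * (1 - p)) powr (1 / (1 - p))) powr (1 - p)"
      using c p by (intro powr_mono2) (auto simp: c_def)
    also have "\<dots> = \<kappa> * (1 - p)" using \<kappa> p by (simp add: powr_powr)
    finally have "c powr (1 - p) * c powr p \<le> \<kappa> * (1 - p) * c powr p"
      by (intro mult_right_mono) auto
    then show ?thesis using c by (simp flip: powr_add)
  qed

  \<comment> \<open>Integrating s^(p \<gamma>) divides by p \<gamma> + 1. The condition (p \<gamma>
    + 1)(1 - p) \<le> 1 caps this divisor by 1/(1 - p), the factor for which c was prepared, so the
    same c works at every stage.\<close>
  have step: "c * t powr (p * \<gamma> + 1) * jb x powr (\<sigma> + p * d) * exp (- K * (q * p) * norm x) \<le> \<mu> t x"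
    if t: "0 \<le> t" "t \<le> T" and \<gamma>: "0 \<le> \<gamma>" "(p * \<gamma> + 1) * (1 - p) \<le> 1" and d: "0 \<le> d" and q: "0 \<le> q" "q \<le> 1"
      and IH: "\<And>t x. 0 \<le> t \<Longrightarrow> t \<le> T \<Longrightarrow> c * t powr \<gamma> * jb x powr d * exp (- K * q * norm x) \<le> \<mu> t x"
    for t x \<gamma> d q
  proof -
    define A where "A = jb x powr (\<sigma> + p * d) * exp (- K * (q * p) * norm x)"
    \<comment> \<open>A step of length 3/2 away from the origin: on the ball of radius 1/2 around
      the new point, |x| + 1 \<le> |y| \<le> |x| + 2. Thus |y| \<ge> 1, as the lower bound on V
      requires, and |y| \<ge> \<open>jb x\<close>, so no weight is lost. At x = 0 any unit vector
      will do.\<close>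
    obtain e :: 'a where e: "norm e = 1" "norm (x + (3/2) *\<^sub>R e) = norm x + 3/2"
    proof (cases "x = 0")
      case True
      obtain i :: 'a where "i \<in> Basis" by (meson ex_in_conv nonempty_Basis)
      then show ?thesis using True that[of i] by simp
    next
      case False
      have "x + (3/2) *\<^sub>R sgn x = (1 + (3/2) * inverse (norm x)) *\<^sub>R x"
        by (simp only: sgn_div_norm scaleR_add_left scaleR_one scaleR_scaleR)
      moreover have "0 \<le> 1 + (3/2) * inverse (norm x)" by simp
      ultimately have "norm (x + (3/2) *\<^sub>R sgn x) = (1 + (3/2) * inverse (norm x)) * norm x"
        by simp
      also have "\<dots> = norm x + 3/2" using False by (simp add: distrib_right)
      finally have "norm (x + (3/2) *\<^sub>R sgn x) = norm x + 3/2" .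
      then show ?thesis using False that[of "sgn x"] by (simp add: norm_sgn)
    qed
    define z where "z = x + (3/2) *\<^sub>R e"
    have xz: "norm (x - z) = 3/2" using e by (simp add: z_def)
    have rhs_ge: "\<kappa> * c powr p * A * s powr (p * \<gamma>) \<le> rhs \<mu> s x" if s: "0 \<le> s" "s \<le> t" for s
    proof (cases "s = 0")
      case True
      then show ?thesis using rhs_nonneg[of 0 \<mu> x] sol_nonneg by simp
    next
      case False
      with s have s0: "0 < s" by simp
      define m where "m = l * exp (- 2 * K) * (c powr p * s powr (p * \<gamma>) * A)"
      have m: "0 \<le> m" using l by (simp add: m_def A_def)
      have src: "m \<le> source \<mu> s y" if y: "y \<in> ball z (1/2)" for y
      proof -
        have "\<bar>norm y - norm z\<bar> \<le> norm (y - z)" by (rule norm_triangle_ineq3)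
        then have ny: "norm x + 1 \<le> norm y" "norm y \<le> norm x + 2"
          using y e(2) unfolding z_def by (auto simp: dist_norm norm_minus_commute)
        have jy: "jb x \<le> jb y" using ny by (intro jb_mono) simp
        have "l * jb x powr \<sigma> \<le> l * norm y powr \<sigma>"
          using jb_le_one_add_norm[of x] ny l sigma by (intro mult_left_mono powr_mono2) auto
        also have "\<dots> \<le> V y s" using s0 s t ny norm_ge_zero[of x] by (intro Vl) linarith+
        finally have V: "l * jb x powr \<sigma> \<le> V y s" .
        have "c * s powr \<gamma> * jb x powr d * exp (- K * q * (norm x + 2))
            \<le> c * s powr \<gamma> * jb y powr d * exp (- K * q * norm y)"
          using c jy d K \<gamma> s mult_left_mono[OF ny(2) q(1)] by (intro mult_mono powr_mono2) auto
        also have "\<dots> \<le> \<mu> s y" using s t by (intro IH) auto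
        finally have "(c * s powr \<gamma> * jb x powr d * exp (- K * q * (norm x + 2))) powr p \<le> \<mu> s y powr p"
          using p c by (intro powr_mono2) auto
        moreover have "(c * s powr \<gamma> * jb x powr d * exp (- K * q * (norm x + 2))) powr p
            = c powr p * s powr (p * \<gamma>) * jb x powr (p * d) * exp (- K * (q * p) * norm x) * exp (- K * (q * p) * 2)"
        proof -
          have "exp (- K * q * (norm x + 2)) powr p = exp (- K * (q * p) * norm x) * exp (- K * (q * p) * 2)"
            unfolding exp_powr_real exp_add[symmetric] by (simp add: algebra_simps)
          then show ?thesis using c by (simp add: powr_mult powr_powr mult.commute[of _ p])
        qed
        ultimately have "c powr p * s powr (p * \<gamma>) * jb x powr (p * d) * exp (- K * (q * p) * norm x) * exp (- K * (q * p) * 2)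
            \<le> \<mu> s y powr p" by simp
        \<comment> \<open>Since q p \<le> 1 the loss is bounded independently of the stage, which
          keeps \<kappa> fixed.\<close>
        moreover have "exp (- 2 * K) \<le> exp (- K * (q * p) * 2)"
          using K q p mult_mono[of q 1 p 1] by simp
        then have "c powr p * s powr (p * \<gamma>) * jb x powr (p * d) * exp (- K * (q * p) * norm x) * exp (- 2 * K)
            \<le> c powr p * s powr (p * \<gamma>) * jb x powr (p * d) * exp (- K * (q * p) * norm x) * exp (- K * (q * p) * 2)"
          by (intro mult_left_mono) auto
        ultimately have "c powr p * s powr (p * \<gamma>) * jb x powr (p * d) * exp (- K * (q * p) * norm x) * exp (- 2 * K)
            \<le> \<mu> s y powr p" by linarith
        with V have "(l * jb x powr \<sigma>) * (c powr p * s powr (p * \<gamma>) * jb x powr (p * d) * exp (- K * (q * p) * norm x) * exp (- 2 * K))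
            \<le> source \<mu> s y"
          unfolding source_def using l s Vnonneg by (intro mult_mono) auto
        then show ?thesis by (simp add: m_def A_def powr_add mult_ac)
      qed
      have "\<kappa> * c powr p * A * s powr (p * \<gamma>)
          = b * exp (- K * (norm (x - z) + 1/2)) * m * measure lborel (ball z (1/2))"
        unfolding \<kappa>_def m_def xz vol_eq[of z] by (simp add: mult_ac)
      also have "\<dots> \<le> besselOp (source \<mu> s) x"
        using s by (intro ball m src) (auto intro: sol_source_integrable source_nonneg)
      also have "\<dots> \<le> exp ((1 - p) * s) * besselOp (source \<mu> s) x"
        using s p mult_right_mono[of 1 "exp ((1 - p) * s)" "besselOp (source \<mu> s) x"]
        by (simp add: besselOp_nonneg source_nonneg)
      also have "\<dots> \<le> rhs \<mu> s x"
        unfolding rhs_def using s by (simp add: besselOp_nonneg sol_nonneg)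
      finally show ?thesis .
    qed
    have "((\<lambda>s. \<kappa> * c powr p * A * s powr (p * \<gamma>)) has_integral
        \<kappa> * c powr p * A * (t powr (p * \<gamma> + 1) / (p * \<gamma> + 1))) {0..t}"
      using t mult_nonneg_nonneg[OF less_imp_le[OF p(1)] \<gamma>(1)]
      by (intro has_integral_mult_right has_integral_powr_from_0) linarith+
    then have "u0 x + \<kappa> * c powr p * A * (t powr (p * \<gamma> + 1) / (p * \<gamma> + 1)) \<le> \<mu> t x"
      using t rhs_ge by (intro sol_ge) auto
    moreover have "c * (p * \<gamma> + 1) \<le> \<kappa> * c powr p"
    proof -
      have "c * (p * \<gamma> + 1) \<le> \<kappa> * (1 - p) * c powr p * (p * \<gamma> + 1)"
        using c_fix \<gamma> p by (intro mult_right_mono) auto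
      also have "\<dots> = \<kappa> * c powr p * ((p * \<gamma> + 1) * (1 - p))" by simp
      also have "\<dots> \<le> \<kappa> * c powr p * 1" using \<gamma> \<kappa> by (intro mult_left_mono) auto
      finally show ?thesis by simp
    qed
    then have "c * (p * \<gamma> + 1) * (A * t powr (p * \<gamma> + 1) / (p * \<gamma> + 1))
        \<le> \<kappa> * c powr p * (A * t powr (p * \<gamma> + 1) / (p * \<gamma> + 1))"
      using \<gamma> p by (intro mult_right_mono) (auto simp: A_def)
    moreover have "c * (p * \<gamma> + 1) * (A * t powr (p * \<gamma> + 1) / (p * \<gamma> + 1)) = c * t powr (p * \<gamma> + 1) * A"
    proof -
      have "p * \<gamma> + 1 > 0" using \<gamma> p by (simp add: add_nonneg_pos)
      then show ?thesis by simp
    qed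
    ultimately show ?thesis using u0(2)[of x] by (simp add: A_def mult_ac)
  qed

  \<comment> \<open>Closed forms of the two recurrences. The indices are offset because the start is
    t^1 with no weight: \<gamma> is 1 and d is 0 at j = 0. As j grows they tend to 1/(1 - p) and
    \<sigma>/(1 - p), while the rate K p^j tends to 0.\<close>
  define \<gamma> where "\<gamma> j = (1 - p ^ Suc j) / (1 - p)" for j
  define d where "d j = \<sigma> * (1 - p ^ j) / (1 - p)" for j
  have pj: "0 \<le> p ^ j" "p ^ j \<le> 1" for j using p by (auto intro: power_le_one)
  have iter: "c * t powr \<gamma> j * jb x powr d j * exp (- K * p ^ j * norm x) \<le> \<mu> t x"
    if "0 \<le> t" "t \<le> T" for t x j
    using that
  proof (induction j arbitrary: t x)
    case 0
    have "c * t * exp (- K * norm x) \<le> c0 * t * exp (- K * norm x)"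
      using c 0 by (intro mult_right_mono) auto
    also have "\<dots> \<le> \<mu> t x" using 0 by (intro start)
    finally show ?case using p 0 by (simp add: \<gamma>_def d_def)
  next
    case (Suc j)
    have \<gamma>: "p * \<gamma> j + 1 = \<gamma> (Suc j)" using p by (simp add: \<gamma>_def field_simps)
    have d: "\<sigma> + p * d j = d (Suc j)" using p by (simp add: d_def field_simps)
    have "c * t powr (p * \<gamma> j + 1) * jb x powr (\<sigma> + p * d j) * exp (- K * (p ^ j * p) * norm x) \<le> \<mu> t x"
    proof (rule step[OF Suc.prems])
      show "0 \<le> \<gamma> j" using pj[of "Suc j"] p by (simp add: \<gamma>_def)
      show "(p * \<gamma> j + 1) * (1 - p) \<le> 1"
        unfolding \<gamma> using pj[of "Suc (Suc j)"] p by (simp add: \<gamma>_def)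
      show "0 \<le> d j" using pj[of j] p sigma by (simp add: d_def)
    qed (use pj Suc.IH in auto)
    then show ?case unfolding \<gamma> d by (simp add: mult_ac)
  qed
  have "c * t powr (1 / (1 - p)) * jb x powr (\<sigma> / (1 - p)) \<le> \<mu> t x" if t: "0 \<le> t" "t \<le> T" for t x
  proof (cases "t = 0")
    case True
    then show ?thesis using sol_nonneg[of 0 x] by simp
  next
    case False
    have p0: "(\<lambda>j. p ^ j) \<longlonglongrightarrow> 0" using p by (intro LIMSEQ_realpow_zero) auto
    have p1: "(\<lambda>j. p ^ Suc j) \<longlonglongrightarrow> 0" using p0 by (rule LIMSEQ_Suc)
    have "(\<lambda>j. c * t powr \<gamma> j * jb x powr d j * exp (- K * p ^ j * norm x)) \<longlonglongrightarrow>
        c * t powr ((1 - 0) / (1 - p)) * jb x powr (\<sigma> * (1 - 0) / (1 - p)) * exp (- K * 0 * norm x)"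
      unfolding \<gamma>_def d_def using False p by (intro tendsto_intros p0 p1) auto
    then show ?thesis using iter[OF t] by (intro LIMSEQ_le_const2[of _ _ "\<mu> t x"]) auto
  qed
  then show ?thesis by (rule that[OF c(1)])
qed

end

text \<open>Subtracting k times one integral equation from the other leaves (1 - k) u0 \<le> 0 from
  the initial data, so an upper bound on the integrand alone controls the difference.\<close>

lemma sol_diff_le:
  assumes \<mu>: "sol \<mu>" and \<nu>: "sol \<nu>" and k: "1 \<le> k" and t: "0 \<le> t" and g: "(g has_integral i) {0..t}"
    and le: "\<And>s. 0 \<le> s \<Longrightarrow> s \<le> t \<Longrightarrow> besselOp (\<lambda>y. \<mu> s y - k * \<nu> s y) x
        + exp ((1 - p) * s) * besselOp (\<lambda>y. source \<mu> s y - k * source \<nu> s y) x \<le> g s"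
  shows "\<mu> t x - k * \<nu> t x \<le> i"
proof -
  let ?D = "\<lambda>s. rhs \<mu> s x - k * rhs \<nu> s x"
  have int: "(\<lambda>s. k * rhs \<nu> s x) integrable_on {0..t}"
    using sol_rhs(1)[OF \<nu> t, of x] integrable_on_mult_right by auto
  have "?D s \<le> g s" if s: "0 \<le> s" "s \<le> t" for s
    using le[OF s] s
    unfolding rhs_def besselOp_diff_cmult(1)[OF sol_integrable[OF \<mu> s(1)] sol_integrable[OF \<nu> s(1)]]
      besselOp_diff_cmult(1)[OF sol_source_integrable[OF \<mu> s(1)] sol_source_integrable[OF \<nu> s(1)]]
    by (simp add: algebra_simps)
  then have "integral {0..t} ?D \<le> integral {0..t} g"
    using sol_rhs(1)[OF \<mu> t] int g
    by (intro Henstock_Kurzweil_Integration.integral_le Henstock_Kurzweil_Integration.integrable_diff) auto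
  moreover have "integral {0..t} ?D = integral {0..t} (\<lambda>s. rhs \<mu> s x) - k * integral {0..t} (\<lambda>s. rhs \<nu> s x)"
    using sol_rhs(1)[OF \<mu> t] int by (subst Henstock_Kurzweil_Integration.integral_diff) auto
  moreover have "u0 x \<le> k * u0 x" using k u0(2)[of x] mult_right_mono[of 1 k "u0 x"] by simp
  ultimately show ?thesis
    using sol_rhs(2)[OF \<mu> t, of x] sol_rhs(2)[OF \<nu> t, of x] g
    by (simp add: integral_unique algebra_simps)
qed

text \<open>The singular comparison. The bound N on the ratio of mu - K nu to the weight improves to
  N/2: one quarter comes from the linear term and one quarter from the source, whose coefficient 1/s
  is compensated by the factor t in the weight.\<close>

lemma sol_le_multiple:
  assumes \<mu>: "sol \<mu>" and \<nu>: "sol \<nu>" and T: "0 \<le> T"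
  obtains K where "1 \<le> K" "\<And>t x. 0 \<le> t \<Longrightarrow> t \<le> T \<Longrightarrow> \<mu> t x \<le> K * \<nu> t x"
proof -
  obtain B where B: "0 < B" and opB:
    "\<And>\<phi> C (x::'a). 0 \<le> C \<Longrightarrow> integrable lborel (\<lambda>y. besselB (x - y) * \<phi> y) \<Longrightarrow>
        (\<And>y. \<phi> y \<le> C * jb y powr a) \<Longrightarrow> besselOp \<phi> x \<le> B * C * jb x powr a"
    by (rule besselOp_le_weight[OF a_nonneg]) blast
  obtain L where L: "0 < L" and VL: "\<And>t x. 0 \<le> t \<Longrightarrow> t \<le> T \<Longrightarrow> V x t \<le> L * jb x powr \<sigma>"
    using Vupper[of T] by blast
  obtain c where c: "0 < c" and low:
    "\<And>t x. 0 \<le> t \<Longrightarrow> t \<le> T \<Longrightarrow> c * t powr (1 / (1 - p)) * jb x powr (\<sigma> / (1 - p)) \<le> \<nu> t x"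
    by (rule sol_lower[OF \<nu>, of T]) blast
  obtain M where M: "\<And>t x. 0 \<le> t \<Longrightarrow> t \<le> T \<Longrightarrow> \<bar>\<mu> t x\<bar> \<le> M * jb x powr a"
    by (rule Zinf_bound[OF sol_Zinf[OF \<mu>] a_nonneg, of T]) blast
  have M0: "0 \<le> M"
    using M[of 0 0] T abs_ge_zero order_trans by (intro weight_const_nonneg[of M 0 a]) blast
  define G where "G = exp ((1 - p) * T)"
  have G: "0 < G" "\<And>s. s \<le> T \<Longrightarrow> exp ((1 - p) * s) \<le> G" using p by (auto simp: G_def)
  \<comment> \<open>Chosen so that (K c)^(1-p) is at least 4 B G L, which is the smallness stated
    next.\<close>
  define K where "K = max 1 ((4 * B * G * L) powr (1 / (1 - p)) / c)"
  have K: "1 \<le> K" by (simp add: K_def)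
  have small: "B * (G * (L * (K * c) powr (p - 1))) \<le> 1 / 4"
  proof -
    have pos: "0 < 4 * B * G * L" using B G L by simp
    have "(4 * B * G * L) powr (1 / (1 - p)) \<le> K * c" using c by (simp add: K_def field_simps max_def)
    then have "((4 * B * G * L) powr (1 / (1 - p))) powr (1 - p) \<le> (K * c) powr (1 - p)"
      using p by (intro powr_mono2) auto
    then have "4 * B * G * L \<le> (K * c) powr (1 - p)" using p pos by (simp add: powr_powr)
    moreover have "(K * c) powr (p - 1) * (K * c) powr (1 - p) = 1"
      using K c by (simp flip: powr_add)
    ultimately have "(K * c) powr (p - 1) * (4 * B * G * L) \<le> 1"
      by (metis mult_left_mono powr_ge_zero)
    then show ?thesis by (simp add: mult_ac)
  qed
  \<comment> \<open>The linear term has size B; integrating the exponential divides by 4 B and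
    leaves one quarter.\<close>
  define \<rho> where "\<rho> = 4 * B"
  have \<rho>: "0 < \<rho>" using B by (simp add: \<rho>_def)
  define S where "S = {0..T} \<times> (UNIV :: 'a set)"
  define E where "E z = (case z of (t, x) \<Rightarrow> \<mu> t x - K * \<nu> t x)" for z
  define w where "w z = (case z of (t, x) \<Rightarrow> t * exp (\<rho> * t) * jb x powr a)" for z :: "real \<times> 'a"
  define N0 where "N0 = B * M + G * (B * (L * M powr p))"
  have N0: "0 \<le> N0" using B M0 G L by (simp add: N0_def)
  have "E z \<le> 0" if "z \<in> S" for z
  proof (rule nonpos_of_halving[where E = E and w = w and S = S and N = N0])
    show "z \<in> S" by fact
    show "0 \<le> N0" by fact
    show "E z \<le> N0 * w z" if "z \<in> S" for z
    proof -
      obtain t x where z: "z = (t, x)" "0 \<le> t" "t \<le> T" using \<open>z \<in> S\<close> by (auto simp: S_def)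
      have "\<mu> t x - K * \<nu> t x \<le> t * (N0 * jb x powr a)"
      proof (rule sol_diff_le[OF \<mu> \<nu> K z(2)])
        show "((\<lambda>s. N0 * jb x powr a) has_integral t * (N0 * jb x powr a)) {0..t}"
          using has_integral_const_real[of "N0 * jb x powr a" 0 t] z by simp
        fix s assume s: "0 \<le> s" "s \<le> t"
        have le: "f - K * g \<le> f" if "0 \<le> g" for f g :: real using K that by simp
        have "besselOp (\<lambda>y. \<mu> s y - K * \<nu> s y) x \<le> B * M * jb x powr a"
        proof (intro opB M0 besselOp_diff_cmult(2) sol_integrable \<mu> \<nu> s)
          show "\<mu> s y - K * \<nu> s y \<le> M * jb y powr a" for y
            using le[OF sol_nonneg[OF \<nu> s(1)], of "\<mu> s y" y] M[of s y] s z by simp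
        qed
        moreover have "besselOp (\<lambda>y. source \<mu> s y - K * source \<nu> s y) x \<le> B * (L * M powr p) * jb x powr a"
        proof (intro opB besselOp_diff_cmult(2) sol_source_integrable \<mu> \<nu> s)
          show "source \<mu> s y - K * source \<nu> s y \<le> L * M powr p * jb y powr a" for y
          proof -
            have "source \<mu> s y \<le> L * M powr p * jb y powr a"
              using VL[of s y] M[of s y] sol_nonneg[OF \<mu>, of s y] s z L M0 by (intro source_le) auto
            then show ?thesis
              using le[OF source_nonneg[OF s(1), of \<nu> y], of "source \<mu> s y"] by simp
          qed
        qed (use L in auto)
        then have "exp ((1 - p) * s) * besselOp (\<lambda>y. source \<mu> s y - K * source \<nu> s y) x
            \<le> G * (B * (L * M powr p) * jb x powr a)"
          using G(2)[of s] s z B L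
          by (intro order_trans[OF mult_left_mono mult_right_mono]) auto
        ultimately show "besselOp (\<lambda>y. \<mu> s y - K * \<nu> s y) x
            + exp ((1 - p) * s) * besselOp (\<lambda>y. source \<mu> s y - K * source \<nu> s y) x \<le> N0 * jb x powr a"
          by (simp add: N0_def algebra_simps)
      qed
      also have "\<dots> \<le> exp (\<rho> * t) * (t * (N0 * jb x powr a))"
        using z \<rho> N0 mult_right_mono[of 1 "exp (\<rho> * t)" "t * (N0 * jb x powr a)"] by simp
      finally show ?thesis by (simp add: z E_def w_def mult_ac)
    qed
    fix N z assume N: "0 \<le> N" and IH: "\<And>z. z \<in> S \<Longrightarrow> E z \<le> N * w z" and "z \<in> S"
    then obtain t x where z: "z = (t, x)" "0 \<le> t" "t \<le> T" by (auto simp: S_def)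
    have E_le: "\<mu> s y - K * \<nu> s y \<le> N * (s * exp (\<rho> * s) * jb y powr a)" if "0 \<le> s" "s \<le> T" for s y
      using IH[of "(s, y)"] that by (simp add: S_def E_def w_def)
    have "\<mu> t x - K * \<nu> t x \<le> N * jb x powr a * (B * t) * ((exp (\<rho> * t) - 1) / \<rho>)
        + t * (N * jb x powr a * exp (\<rho> * t) / 4)"
    proof (rule sol_diff_le[OF \<mu> \<nu> K z(2)])
      show "((\<lambda>s. N * jb x powr a * (B * t) * exp (\<rho> * s) + N * jb x powr a * exp (\<rho> * t) / 4) has_integral
          N * jb x powr a * (B * t) * ((exp (\<rho> * t) - 1) / \<rho>) + t * (N * jb x powr a * exp (\<rho> * t) / 4)) {0..t}"
        using has_integral_const_real[of "N * jb x powr a * exp (\<rho> * t) / 4" 0 t] z \<rho>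
        by (intro has_integral_add has_integral_mult_right has_integral_exp_real) auto
      fix s assume s: "0 \<le> s" "s \<le> t"
      have "besselOp (\<lambda>y. \<mu> s y - K * \<nu> s y) x \<le> B * (N * (s * exp (\<rho> * s))) * jb x powr a"
        using E_le[of s] s z N
        by (intro opB besselOp_diff_cmult(2) sol_integrable \<mu> \<nu>) (auto simp: mult_ac)
      \<comment> \<open>Replacing the factor s by t leaves a pure exponential to integrate and
        supplies the factor t of \<open>w\<close>.\<close>
      also have "\<dots> \<le> B * (N * (t * exp (\<rho> * s))) * jb x powr a"
        using s N B by (intro mult_right_mono mult_left_mono) auto
      finally have 1: "besselOp (\<lambda>y. \<mu> s y - K * \<nu> s y) x \<le> N * jb x powr a * (B * t) * exp (\<rho> * s)"
        by (simp add: mult_ac)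
      let ?C = "L * (K * c) powr (p - 1) * N * exp (\<rho> * s)"
      have C: "0 \<le> ?C" using L N by simp
      have "source \<mu> s y - K * source \<nu> s y \<le> ?C * jb y powr a" for y
      \<comment> \<open>At s = 0 the lower bound on \<nu> degenerates, but there both solutions
        equal u0 and K \<ge> 1 decides the sign.\<close>
      proof (cases "s = 0")
        case True
        have eq: "\<mu> 0 y = \<nu> 0 y" using sol_rhs(2)[OF \<mu>, of 0 y] sol_rhs(2)[OF \<nu>, of 0 y] by simp
        have "source \<mu> s y \<le> K * source \<nu> s y"
          using True K source_nonneg[of 0 \<nu> y] mult_right_mono[of 1 K "source \<nu> 0 y"]
          by (simp add: source_def eq)
        then show ?thesis using C by (smt (verit) mult_nonneg_nonneg powr_ge_zero)
      next
        case False
        with s have s0: "0 < s" by simp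
        let ?S = "s powr (1 / (1 - p)) * jb y powr (\<sigma> / (1 - p))"
        have S: "0 < ?S" using s0 by simp
        have low': "c * ?S \<le> \<nu> s y" using low[of s y] s z by (simp add: mult_ac)
        have \<nu>0: "0 < \<nu> s y" using low' S c by (smt (verit) mult_pos_pos)
        \<comment> \<open>These exponents turn the lower bound into s^(-1) times \<open>jb\<close>
          ^(-\<sigma>): the first factor meets the s in the weight, the second the growth of
          V.\<close>
        have exps: "(1 / (1 - p)) * (p - 1) = -1" "(\<sigma> / (1 - p)) * (p - 1) = - \<sigma>"
          using p by (auto simp: field_simps)
        have "(K * \<nu> s y) powr (p - 1) \<le> ((K * c) * ?S) powr (p - 1)"
          using low' S c K p by (intro powr_mono2') (auto simp: mult.assoc intro!: mult_left_mono)
        also have "\<dots> = (K * c) powr (p - 1) * (s powr (-1) * jb y powr (- \<sigma>))"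
          using K c by (simp add: powr_mult powr_powr exps del: times_divide_eq_left)
        finally have pw: "(K * \<nu> s y) powr (p - 1) \<le> (K * c) powr (p - 1) * (s powr (-1) * jb y powr (- \<sigma>))" .
        have max: "max (\<mu> s y - K * \<nu> s y) 0 \<le> N * (s * exp (\<rho> * s) * jb y powr a)"
          using E_le[of s y] s z N by simp
        have "\<mu> s y powr p - K * \<nu> s y powr p \<le> (K * \<nu> s y) powr (p - 1) * max (\<mu> s y - K * \<nu> s y) 0"
          using sol_nonneg[OF \<mu>, of s y] s \<nu>0 K p by (intro powr_diff_le) auto
        also have "\<dots> \<le> ((K * c) powr (p - 1) * (s powr (-1) * jb y powr (- \<sigma>))) * (N * (s * exp (\<rho> * s) * jb y powr a))"
          using pw max by (intro mult_mono) auto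
        also have "\<dots> = (K * c) powr (p - 1) * N * exp (\<rho> * s) * (jb y powr (- \<sigma>) * jb y powr a)"
          using s0 by (simp add: powr_minus field_simps)
        finally have "V y s * (\<mu> s y powr p - K * \<nu> s y powr p)
            \<le> (L * jb y powr \<sigma>) * ((K * c) powr (p - 1) * N * exp (\<rho> * s) * (jb y powr (- \<sigma>) * jb y powr a))"
          using VL[of s y] Vnonneg[of s y] s z N L
          by (intro order_trans[OF mult_left_mono mult_right_mono]) auto
        also have "\<dots> = ?C * jb y powr a"
          by (simp add: powr_minus field_simps)
        finally show ?thesis by (simp add: source_def algebra_simps)
      qed
      then have "besselOp (\<lambda>y. source \<mu> s y - K * source \<nu> s y) x \<le> B * ?C * jb x powr a"
        using s z C by (intro opB besselOp_diff_cmult(2) sol_source_integrable \<mu> \<nu>) auto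
      then have "exp ((1 - p) * s) * besselOp (\<lambda>y. source \<mu> s y - K * source \<nu> s y) x
          \<le> G * (B * ?C * jb x powr a)"
        using G(2)[of s] s z B C
        by (intro order_trans[OF mult_left_mono mult_right_mono]) auto
      also have "\<dots> = B * (G * (L * (K * c) powr (p - 1))) * (N * exp (\<rho> * s) * jb x powr a)"
        by (simp add: mult_ac)
      \<comment> \<open>Freezing the exponential at t makes this bound constant in s, so that its
        integral restores the factor t of \<open>w\<close>.\<close>
      also have "\<dots> \<le> 1 / 4 * (N * exp (\<rho> * t) * jb x powr a)"
        using small s \<rho> N by (intro mult_mono) auto
      finally show "besselOp (\<lambda>y. \<mu> s y - K * \<nu> s y) x
          + exp ((1 - p) * s) * besselOp (\<lambda>y. source \<mu> s y - K * source \<nu> s y) x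
          \<le> N * jb x powr a * (B * t) * exp (\<rho> * s) + N * jb x powr a * exp (\<rho> * t) / 4"
        using 1 by (simp add: mult_ac)
    qed
    also have "N * jb x powr a * (B * t) * ((exp (\<rho> * t) - 1) / \<rho>) = (N * jb x powr a * t * (exp (\<rho> * t) - 1)) / 4"
      using B by (simp add: \<rho>_def)
    also have "\<dots> \<le> (N * jb x powr a * t * exp (\<rho> * t)) / 4"
      using N z by (intro divide_right_mono mult_left_mono) auto
    finally show "E z \<le> N / 2 * w z" by (simp add: z E_def w_def mult_ac)
  qed
  then have "\<mu> t x \<le> K * \<nu> t x" if "0 \<le> t" "t \<le> T" for t x
    using that unfolding S_def E_def by fastforce
  then show ?thesis using K by (intro that)
qed

text \<open>By homogeneity mu \<le> K nu gives mu^p \<le> K^p nu^p, so the source of mu - K^p nu is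
  nonpositive. Only the linear term remains; nothing is singular, and the weight exp(\<rho> t) with
  \<rho> = 2 B already halves every bound.\<close>

lemma sol_le_multiple_improve:
  assumes \<mu>: "sol \<mu>" and \<nu>: "sol \<nu>" and T: "0 \<le> T" and K: "1 \<le> K"
    and le: "\<And>t x. 0 \<le> t \<Longrightarrow> t \<le> T \<Longrightarrow> \<mu> t x \<le> K * \<nu> t x"
    and t: "0 \<le> t" "t \<le> T"
  shows "\<mu> t x \<le> K powr p * \<nu> t x"
proof -
  obtain B where B: "0 < B" and opB:
    "\<And>\<phi> C (x::'a). 0 \<le> C \<Longrightarrow> integrable lborel (\<lambda>y. besselB (x - y) * \<phi> y) \<Longrightarrow>
        (\<And>y. \<phi> y \<le> C * jb y powr a) \<Longrightarrow> besselOp \<phi> x \<le> B * C * jb x powr a"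
    by (rule besselOp_le_weight[OF a_nonneg]) blast
  obtain M where M: "\<And>t x. 0 \<le> t \<Longrightarrow> t \<le> T \<Longrightarrow> \<bar>\<mu> t x\<bar> \<le> M * jb x powr a"
    by (rule Zinf_bound[OF sol_Zinf[OF \<mu>] a_nonneg, of T]) blast
  have M0: "0 \<le> M"
    using M[of 0 0] T abs_ge_zero order_trans by (intro weight_const_nonneg[of M 0 a]) blast
  have Kp: "1 \<le> K powr p" using K p by (intro ge_one_powr_ge_zero) auto
  define \<rho> where "\<rho> = 2 * B"
  have \<rho>: "0 < \<rho>" using B by (simp add: \<rho>_def)
  define S where "S = {0..T} \<times> (UNIV :: 'a set)"
  define E where "E z = (case z of (t, x) \<Rightarrow> \<mu> t x - K powr p * \<nu> t x)" for z
  define w where "w z = (case z of (t, x) \<Rightarrow> exp (\<rho> * t) * jb x powr a)" for z :: "real \<times> 'a"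
  have "E (t, x) \<le> 0"
  proof (rule nonpos_of_halving[where E = E and w = w and S = S and N = M])
    show "(t, x) \<in> S" using t by (simp add: S_def)
    show "0 \<le> M" by fact
    show "E z \<le> M * w z" if zS: "z \<in> S" for z
    proof -
      obtain t x where z: "z = (t, x)" "0 \<le> t" "t \<le> T" using zS by (auto simp: S_def)
      have "0 \<le> K powr p * \<nu> t x" using sol_nonneg[OF \<nu> z(2)] by simp
      then have "\<mu> t x - K powr p * \<nu> t x \<le> M * jb x powr a"
        using M[of t x] z by linarith
      also have "\<dots> \<le> exp (\<rho> * t) * (M * jb x powr a)"
        using z \<rho> M0 mult_right_mono[of 1 "exp (\<rho> * t)" "M * jb x powr a"] by simp
      finally show ?thesis by (simp add: z E_def w_def mult_ac)
    qed
    fix N z assume N: "0 \<le> N" and IH: "\<And>z. z \<in> S \<Longrightarrow> E z \<le> N * w z" and "z \<in> S"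
    then obtain t x where z: "z = (t, x)" "0 \<le> t" "t \<le> T" by (auto simp: S_def)
    have E_le: "\<mu> s y - K powr p * \<nu> s y \<le> N * (exp (\<rho> * s) * jb y powr a)" if "0 \<le> s" "s \<le> T" for s y
      using IH[of "(s, y)"] that by (simp add: S_def E_def w_def)
    have "\<mu> t x - K powr p * \<nu> t x \<le> B * N * jb x powr a * ((exp (\<rho> * t) - 1) / \<rho>)"
    proof (rule sol_diff_le[OF \<mu> \<nu> Kp z(2)])
      show "((\<lambda>s. B * N * jb x powr a * exp (\<rho> * s)) has_integral
          B * N * jb x powr a * ((exp (\<rho> * t) - 1) / \<rho>)) {0..t}"
        using z \<rho> by (intro has_integral_mult_right has_integral_exp_real) auto
      fix s assume s: "0 \<le> s" "s \<le> t"
      have "besselOp (\<lambda>y. \<mu> s y - K powr p * \<nu> s y) x \<le> B * (N * exp (\<rho> * s)) * jb x powr a"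
        using E_le[of s] s z N
        by (intro opB besselOp_diff_cmult(2) sol_integrable \<mu> \<nu>) (auto simp: mult_ac)
      moreover have "besselOp (\<lambda>y. source \<mu> s y - K powr p * source \<nu> s y) x \<le> B * 0 * jb x powr a"
      proof (intro opB besselOp_diff_cmult(2) sol_source_integrable \<mu> \<nu> s)
        show "source \<mu> s y - K powr p * source \<nu> s y \<le> 0 * jb y powr a" for y
        proof -
          have "\<mu> s y powr p \<le> (K * \<nu> s y) powr p"
            using le[of s y] s z p sol_nonneg[OF \<mu> s(1)] by (intro powr_mono2) auto
          also have "\<dots> = K powr p * \<nu> s y powr p"
            using K sol_nonneg[OF \<nu> s(1), of y] by (simp add: powr_mult)
          finally have "V y s * \<mu> s y powr p \<le> V y s * (K powr p * \<nu> s y powr p)"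
            using Vnonneg[OF s(1)] by (intro mult_left_mono)
          then show ?thesis by (simp add: source_def mult_ac)
        qed
      qed simp
      then have "exp ((1 - p) * s) * besselOp (\<lambda>y. source \<mu> s y - K powr p * source \<nu> s y) x \<le> 0"
        by (simp add: mult_le_0_iff)
      ultimately show "besselOp (\<lambda>y. \<mu> s y - K powr p * \<nu> s y) x
          + exp ((1 - p) * s) * besselOp (\<lambda>y. source \<mu> s y - K powr p * source \<nu> s y) x
          \<le> B * N * jb x powr a * exp (\<rho> * s)"
        by (simp add: mult_ac)
    qed
    also have "\<dots> = N * jb x powr a * (exp (\<rho> * t) - 1) / 2"
      using B by (simp add: \<rho>_def)
    also have "\<dots> \<le> N * jb x powr a * exp (\<rho> * t) / 2"
      using N by (intro divide_right_mono mult_left_mono) auto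
    finally show "E z \<le> N / 2 * w z" by (simp add: z E_def w_def mult_ac)
  qed
  then show ?thesis by (simp add: E_def)
qed

lemma sol_le:
  assumes \<mu>: "sol \<mu>" and \<nu>: "sol \<nu>" and t: "0 \<le> t"
  shows "\<mu> t x \<le> \<nu> t x"
proof -
  obtain K where K: "1 \<le> K" "\<And>s x. 0 \<le> s \<Longrightarrow> s \<le> t \<Longrightarrow> \<mu> s x \<le> K * \<nu> s x"
    by (rule sol_le_multiple[OF \<mu> \<nu> t]) blast
  have "\<forall>s x. 0 \<le> s \<longrightarrow> s \<le> t \<longrightarrow> \<mu> s x \<le> K powr (p ^ j) * \<nu> s x" for j
  proof (induction j)
    case 0
    then show ?case using K by simp
  next
    case (Suc j)
    have "1 \<le> K powr (p ^ j)" using K p by (intro ge_one_powr_ge_zero) auto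
    from sol_le_multiple_improve[OF \<mu> \<nu> t this] Suc show ?case
      by (simp add: powr_powr mult.commute)
  qed
  then have "\<mu> t x \<le> K powr (p ^ j) * \<nu> t x" for j using t by simp
  moreover have "(\<lambda>j. K powr (p ^ j) * \<nu> t x) \<longlonglongrightarrow> K powr 0 * \<nu> t x"
    using K p by (intro tendsto_intros LIMSEQ_realpow_zero) auto
  ultimately have "\<mu> t x \<le> K powr 0 * \<nu> t x"
    using LIMSEQ_le_const by blast
  then show ?thesis using K by simp
qed

lemma sol_unique: "sol \<mu> \<Longrightarrow> sol \<nu> \<Longrightarrow> 0 \<le> t \<Longrightarrow> \<mu> t x = \<nu> t x"
  using sol_le[of \<mu> \<nu> t x] sol_le[of \<nu> \<mu> t x] by simp

section \<open>Existence\<close>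

text \<open>Only measurability in x is required, because this is what survives a pointwise limit of
  iterates; continuity is recovered later by applying the equation once.\<close>

definition adm :: "(real \<Rightarrow> 'a \<Rightarrow> real) \<Rightarrow> bool" where
  "adm f \<longleftrightarrow> (\<forall>t\<ge>0. f t \<in> borel_measurable borel) \<and> (\<forall>t\<ge>0. \<forall>x. 0 \<le> f t x) \<and>
     (\<forall>T. \<exists>M\<ge>0. \<forall>t x. 0 \<le> t \<and> t \<le> T \<longrightarrow> f t x \<le> M * jb x powr a)"

lemma V_continuous_space: "0 \<le> t \<Longrightarrow> continuous_on UNIV (\<lambda>x. V x t)"
proof -
  assume "0 \<le> t"
  then have "continuous_on UNIV (\<lambda>x. case (x, t) of (x, t) \<Rightarrow> V x t)"
    by (intro continuous_on_compose2[OF Vcont]) (auto intro!: continuous_intros)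
  then show ?thesis by simp
qed

lemma V_continuous_time: "continuous_on {0..T} (\<lambda>t. V x t)"
proof -
  have "continuous_on {0..T} (\<lambda>t. case (x, t) of (x, t) \<Rightarrow> V x t)"
    by (intro continuous_on_compose2[OF Vcont]) (auto intro!: continuous_intros)
  then show ?thesis by simp
qed

lemma adm_measurable: "adm f \<Longrightarrow> 0 \<le> t \<Longrightarrow> f t \<in> borel_measurable borel"
  and adm_nonneg: "adm f \<Longrightarrow> 0 \<le> t \<Longrightarrow> 0 \<le> f t x"
  by (auto simp: adm_def)

lemma source_measurable:
  assumes "adm f" "0 \<le> t"
  shows "source f t \<in> borel_measurable borel"
proof -
  have [measurable]: "(\<lambda>x. V x t) \<in> borel_measurable borel" "f t \<in> borel_measurable borel"
    using assms V_continuous_space borel_measurable_continuous_onI by (auto simp: adm_def)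
  show ?thesis unfolding source_def by measurable
qed

lemma adm_bounds:
  assumes "adm f"
  obtains C where "0 \<le> C" "\<And>t x. 0 \<le> t \<Longrightarrow> t \<le> T \<Longrightarrow> f t x \<le> C * jb x powr a"
    "\<And>t x. 0 \<le> t \<Longrightarrow> t \<le> T \<Longrightarrow> source f t x \<le> C * jb x powr a"
proof -
  obtain M where M: "0 \<le> M" "\<And>t x. 0 \<le> t \<Longrightarrow> t \<le> T \<Longrightarrow> f t x \<le> M * jb x powr a"
    using assms unfolding adm_def by meson
  obtain L where L: "0 < L" "\<And>t x. 0 \<le> t \<Longrightarrow> t \<le> T \<Longrightarrow> V x t \<le> L * jb x powr \<sigma>"
    using Vupper[of T] by blast
  show ?thesis
  proof
    show "0 \<le> M + L * M powr p" using M L by simp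
    fix t x assume t: "0 \<le> t" "t \<le> T"
    have "source f t x \<le> L * M powr p * jb x powr a"
      using adm_nonneg[OF assms] t M L by (intro source_le) auto
    then show "source f t x \<le> (M + L * M powr p) * jb x powr a"
      using M(1) by (simp add: distrib_right add_increasing)
    show "f t x \<le> (M + L * M powr p) * jb x powr a"
      using M(2)[OF t, of x] L(1) by (simp add: distrib_right add_increasing2)
  qed
qed

lemma adm_integrable:
  assumes "adm f" "0 \<le> t"
  shows "integrable lborel (\<lambda>y. besselB (x - y) * f t y)"
    and "integrable lborel (\<lambda>y. besselB (x - y) * source f t y)"
proof -
  obtain C where "0 \<le> C" "\<And>s x. 0 \<le> s \<Longrightarrow> s \<le> t \<Longrightarrow> f s x \<le> C * jb x powr a"
    "\<And>s x. 0 \<le> s \<Longrightarrow> s \<le> t \<Longrightarrow> source f s x \<le> C * jb x powr a"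
    by (rule adm_bounds[OF assms(1), of t]) blast
  then show "integrable lborel (\<lambda>y. besselB (x - y) * f t y)"
    "integrable lborel (\<lambda>y. besselB (x - y) * source f t y)"
    using assms adm_nonneg[OF assms] source_nonneg[OF assms(2)]
    by (auto intro!: integrable_bessel[OF a_nonneg, of _ C] adm_measurable source_measurable)
qed

lemma adm_rhs_bound:
  assumes "adm f"
  obtains C where "0 \<le> C" "\<And>t x. 0 \<le> t \<Longrightarrow> t \<le> T \<Longrightarrow> \<bar>rhs f t x\<bar> \<le> C * jb x powr a"
proof -
  obtain B where B: "0 < B" and opB:
    "\<And>\<phi> C (x::'a). 0 \<le> C \<Longrightarrow> integrable lborel (\<lambda>y. besselB (x - y) * \<phi> y) \<Longrightarrow>
        (\<And>y. \<phi> y \<le> C * jb y powr a) \<Longrightarrow> besselOp \<phi> x \<le> B * C * jb x powr a"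
    by (rule besselOp_le_weight[OF a_nonneg]) blast
  obtain C where C: "0 \<le> C" "\<And>t x. 0 \<le> t \<Longrightarrow> t \<le> T \<Longrightarrow> f t x \<le> C * jb x powr a"
    "\<And>t x. 0 \<le> t \<Longrightarrow> t \<le> T \<Longrightarrow> source f t x \<le> C * jb x powr a"
    by (rule adm_bounds[OF assms, of T]) blast
  let ?G = "exp ((1 - p) * T)"
  show ?thesis
  proof
    show "0 \<le> B * C + ?G * (B * C)" using B C by simp
    fix t x assume t: "0 \<le> t" "t \<le> T"
    have "besselOp (f t) x \<le> B * C * jb x powr a"
      using assms t C by (intro opB adm_integrable) auto
    moreover have "exp ((1 - p) * t) * besselOp (source f t) x \<le> ?G * (B * C * jb x powr a)"
    proof (intro mult_mono)
      show "exp ((1 - p) * t) \<le> ?G" using t p by simp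
      show "besselOp (source f t) x \<le> B * C * jb x powr a"
        using assms t C by (intro opB adm_integrable) auto
    qed (use t in \<open>auto intro: besselOp_nonneg source_nonneg\<close>)
    moreover have "0 \<le> rhs f t x" using adm_nonneg[OF assms] t by (intro rhs_nonneg) auto
    ultimately show "\<bar>rhs f t x\<bar> \<le> (B * C + ?G * (B * C)) * jb x powr a"
      unfolding rhs_def by (simp add: algebra_simps)
  qed
qed

lemma rhs_mono:
  assumes f: "adm f" and g: "adm g" and t: "0 \<le> t" and le: "\<And>y. f t y \<le> g t y"
  shows "rhs f t x \<le> rhs g t x"
proof -
  have "source f t y \<le> source g t y" for y
    unfolding source_def using adm_nonneg[OF f t, of y] le[of y] p Vnonneg[OF t]
    by (intro mult_left_mono powr_mono2) auto
  then have "besselOp (source f t) x \<le> besselOp (source g t) x"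
    using f g t by (intro besselOp_mono adm_integrable)
  moreover have "besselOp (f t) x \<le> besselOp (g t) x"
    using f g t le by (intro besselOp_mono adm_integrable)
  ultimately show ?thesis unfolding rhs_def by (intro add_mono mult_left_mono) auto
qed

lemma rhs_continuous_space:
  assumes f: "adm f" and t: "0 \<le> t"
  shows "continuous_on UNIV (rhs f t)"
proof -
  obtain C where C: "0 \<le> C" "\<And>s x. 0 \<le> s \<Longrightarrow> s \<le> t \<Longrightarrow> f s x \<le> C * jb x powr a"
    "\<And>s x. 0 \<le> s \<Longrightarrow> s \<le> t \<Longrightarrow> source f s x \<le> C * jb x powr a"
    by (rule adm_bounds[OF f, of t]) blast
  have "continuous_on UNIV (besselOp (f t))"
    using adm_nonneg[OF f t] f t C by (intro besselOp_continuous[OF a_nonneg, of _ C] adm_measurable) auto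
  moreover have "continuous_on UNIV (besselOp (source f t))"
    using f t C by (intro besselOp_continuous[OF a_nonneg, of _ C] source_measurable source_nonneg) auto
  ultimately show ?thesis unfolding rhs_def by (intro continuous_intros)
qed

text \<open>Dominated convergence along sequences of times. This is how the time integrals of the
  iterates are known to exist.\<close>

lemma besselOp_continuous_time:
  assumes f: "adm f" and cont: "\<And>x. continuous_on {0..T} (\<lambda>t. f t x)"
  shows "continuous_on {0..T} (\<lambda>t. besselOp (f t) x)"
    and "continuous_on {0..T} (\<lambda>t. besselOp (source f t) x)"
proof -
  obtain C where C: "0 \<le> C" "\<And>s x. 0 \<le> s \<Longrightarrow> s \<le> T \<Longrightarrow> f s x \<le> C * jb x powr a"
    "\<And>s x. 0 \<le> s \<Longrightarrow> s \<le> T \<Longrightarrow> source f s x \<le> C * jb x powr a"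
    by (rule adm_bounds[OF f, of T]) blast
  have seq: "continuous_on {0..T} (\<lambda>t. besselOp (g t) x)"
    if meas: "\<And>t. 0 \<le> t \<Longrightarrow> g t \<in> borel_measurable borel" and nn: "\<And>t y. 0 \<le> t \<Longrightarrow> 0 \<le> g t y"
      and bd: "\<And>t y. 0 \<le> t \<Longrightarrow> t \<le> T \<Longrightarrow> g t y \<le> C * jb y powr a"
      and g: "\<And>y. continuous_on {0..T} (\<lambda>t. g t y)" for g :: "real \<Rightarrow> 'a \<Rightarrow> real"
    unfolding continuous_on_sequentially comp_def
  proof (intro ballI allI impI)
    fix t X assume t: "t \<in> {0..T}" and X: "(\<forall>n. X n \<in> {0..T}) \<and> X \<longlonglongrightarrow> t"
    show "(\<lambda>n. besselOp (g (X n)) x) \<longlonglongrightarrow> besselOp (g t) x"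
    proof (rule tendsto_besselOp[OF a_nonneg, where C = C])
      show "g (X n) \<in> borel_measurable borel" for n using X by (intro meas) auto
      show "g t \<in> borel_measurable borel" using t by (intro meas) auto
      show "\<bar>g (X n) y\<bar> \<le> C * jb y powr a" for n y using X nn[of "X n" y] bd[of "X n" y] by auto
      show "(\<lambda>n. g (X n) y) \<longlonglongrightarrow> g t y" for y
        using g[of y] t X unfolding continuous_on_sequentially comp_def by blast
    qed
  qed
  show "continuous_on {0..T} (\<lambda>t. besselOp (f t) x)"
    using adm_nonneg[OF f] f C cont by (intro seq) (auto intro: adm_measurable)
  have "continuous_on {0..T} (\<lambda>t. source f t y)" for y
    unfolding source_def using p adm_nonneg[OF f]
    by (intro continuous_on_mult V_continuous_time continuous_on_powr' cont) auto
  then show "continuous_on {0..T} (\<lambda>t. besselOp (source f t) x)"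
    using f C by (intro seq) (auto intro: source_measurable source_nonneg)
qed

text \<open>Integrability in time is assumed directly instead of continuity in time, so that the
  lemma applies to the limit of the iterates as well as to the iterates. Along a convergent sequence
  the weight is bounded, which provides the dominating constant.\<close>

lemma integral_rhs_continuous_space:
  assumes f: "adm f" and int: "\<And>x. (\<lambda>s. rhs f s x) integrable_on {0..t}"
  shows "continuous_on UNIV (\<lambda>x. integral {0..t} (\<lambda>s. rhs f s x))"
  unfolding continuous_on_sequentially comp_def
proof (intro ballI allI impI)
  fix x X assume "(\<forall>n. X n \<in> UNIV) \<and> X \<longlonglongrightarrow> (x::'a)"
  then have X: "X \<longlonglongrightarrow> x" by simp
  obtain R where R: "\<And>k. norm (X k) \<le> R"
    using convergent_imp_Bseq[of X] X by (auto simp: Bseq_def convergent_def)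
  obtain C where C: "0 \<le> C" "\<And>s x. 0 \<le> s \<Longrightarrow> s \<le> t \<Longrightarrow> \<bar>rhs f s x\<bar> \<le> C * jb x powr a"
    by (rule adm_rhs_bound[OF f, of t]) blast
  show "(\<lambda>n. integral {0..t} (\<lambda>s. rhs f s (X n))) \<longlonglongrightarrow> integral {0..t} (\<lambda>s. rhs f s x)"
  proof (rule dominated_convergence)
    show "(\<lambda>s. rhs f s (X n)) integrable_on {0..t}" for n by (rule int)
    show "(\<lambda>_. C * (1 + R) powr a) integrable_on {0..t}" by (rule integrable_const_ivl)
    show "norm (rhs f s (X n)) \<le> C * (1 + R) powr a" if "s \<in> {0..t}" for n s
    proof -
      have "jb (X n) powr a \<le> (1 + R) powr a"
        using R[of n] jb_le_one_add_norm[of "X n"] a_nonneg by (intro powr_mono2) auto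
      then have "C * jb (X n) powr a \<le> C * (1 + R) powr a" using C by (intro mult_left_mono)
      then show ?thesis using C(2)[of s "X n"] that by simp
    qed
    show "(\<lambda>n. rhs f s (X n)) \<longlonglongrightarrow> rhs f s x" if "s \<in> {0..t}" for s
      using that by (intro continuous_on_tendsto_compose[OF rhs_continuous_space[OF f] X]) auto
  qed
qed

section \<open>Monotone Picard iteration\<close>

definition picard :: "(real \<Rightarrow> 'a \<Rightarrow> real) \<Rightarrow> real \<Rightarrow> 'a \<Rightarrow> real" where
  "picard f t x = u0 x + integral {0..t} (\<lambda>s. rhs f s x)"

lemma u0_bound: obtains C where "0 \<le> C" "\<And>x. u0 x \<le> C * jb x powr a"
proof -
  obtain C where C: "\<And>x. \<bar>u0 x\<bar> \<le> C * jb x powr a"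
    by (rule BC_bound[OF u0(1) a_nonneg]) blast
  have "0 \<le> C"
    using C[of 0] abs_ge_zero order_trans by (intro weight_const_nonneg[of C 0 a]) blast
  then show ?thesis using C by (intro that[of C]) (auto intro: order_trans[OF abs_ge_self])
qed

lemma u0_continuous: "continuous_on UNIV u0"
  using u0(1) by (simp add: BC_def)

lemma rhs_integrable:
  assumes f: "adm f" and cont: "\<And>T x. continuous_on {0..T} (\<lambda>t. f t x)"
  shows "(\<lambda>s. rhs f s x) integrable_on {0..t}"
  unfolding rhs_def using besselOp_continuous_time[OF f cont]
  by (intro integrable_continuous_real continuous_intros)

lemma picard_step:
  assumes f: "adm f" and cont: "\<And>T x. continuous_on {0..T} (\<lambda>t. f t x)"
  shows "adm (picard f)" and "continuous_on {0..T} (\<lambda>t. picard f t x)"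
proof -
  note int = rhs_integrable[OF f cont]
  show "continuous_on {0..T} (\<lambda>t. picard f t x)"
    unfolding picard_def by (intro continuous_intros indefinite_integral_continuous_1 int)
  show "adm (picard f)"
    unfolding adm_def
  proof (intro conjI allI impI)
    fix t :: real assume t: "0 \<le> t"
    show "picard f t \<in> borel_measurable borel"
      unfolding picard_def
      by (intro borel_measurable_continuous_onI continuous_intros u0_continuous integral_rhs_continuous_space f int)
    show "0 \<le> picard f t x" for x
      unfolding picard_def using adm_nonneg[OF f] u0(2)[of x]
      by (intro add_nonneg_nonneg Henstock_Kurzweil_Integration.integral_nonneg int)
        (auto intro: rhs_nonneg)
  next
    fix T
    obtain C where C: "0 \<le> C" "\<And>x. u0 x \<le> C * jb x powr a" by (rule u0_bound) blast
    obtain D where D: "0 \<le> D" "\<And>s x. 0 \<le> s \<Longrightarrow> s \<le> T \<Longrightarrow> \<bar>rhs f s x\<bar> \<le> D * jb x powr a"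
      by (rule adm_rhs_bound[OF f, of T]) blast
    have "picard f t x \<le> (C + D * \<bar>T\<bar>) * jb x powr a" if t: "0 \<le> t" "t \<le> T" for t x
    proof -
      have "integral {0..t} (\<lambda>s. rhs f s x) \<le> integral {0..t} (\<lambda>s. D * jb x powr a)"
        using D(2)[of _ x] t by (intro Henstock_Kurzweil_Integration.integral_le int integrable_const_ivl)
          (auto intro: order_trans[OF abs_ge_self])
      also have "\<dots> = t * (D * jb x powr a)" using t by simp
      also have "\<dots> \<le> \<bar>T\<bar> * (D * jb x powr a)" using t D by (intro mult_right_mono) auto
      finally show ?thesis unfolding picard_def using C(2)[of x] by (simp add: algebra_simps)
    qed
    then show "\<exists>M\<ge>0. \<forall>t x. 0 \<le> t \<and> t \<le> T \<longrightarrow> picard f t x \<le> M * jb x powr a"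
      using C D by (intro exI[of _ "C + D * \<bar>T\<bar>"]) auto
  qed
qed

definition iter :: "nat \<Rightarrow> real \<Rightarrow> 'a \<Rightarrow> real" where
  "iter k = (picard ^^ k) (\<lambda>t x. 0)"

lemma iter_0: "iter 0 t x = 0" and iter_Suc: "iter (Suc k) = picard (iter k)"
  by (simp_all add: iter_def)

lemma iter_adm: "adm (iter k)" and iter_continuous_time: "continuous_on {0..T} (\<lambda>t. iter k t x)"
proof -
  have "adm (iter k) \<and> (\<forall>T x. continuous_on {0..T} (\<lambda>t. iter k t x))"
  proof (induction k)
    case 0
    then show ?case by (auto simp: adm_def iter_def)
  next
    case (Suc k)
    then show ?case unfolding iter_Suc using picard_step[of "iter k"] by blast
  qed
  then show "adm (iter k)" "continuous_on {0..T} (\<lambda>t. iter k t x)" by auto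
qed

lemma iter_mono: "0 \<le> t \<Longrightarrow> iter k t x \<le> iter (Suc k) t x"
proof (induction k arbitrary: t x)
  case 0
  then show ?case unfolding iter_0 by (intro adm_nonneg[OF iter_adm])
next
  case (Suc k)
  have "picard (iter k) t x \<le> picard (iter (Suc k)) t x"
    unfolding picard_def
    by (intro add_left_mono Henstock_Kurzweil_Integration.integral_le rhs_integrable iter_adm
        iter_continuous_time rhs_mono Suc.IH) auto
  then show ?case by (simp only: iter_Suc)
qed

text \<open>The function \<open>M exp (\<rho> t) jb x powr a\<close> is a supersolution on \<open>[0, T]\<close> for large \<open>\<rho>\<close>,
  since \<open>M powr p \<le> M\<close>.\<close>
lemma iter_bound:
  assumes T: "0 \<le> T"
  obtains M where "0 \<le> M" "\<And>k t x. 0 \<le> t \<Longrightarrow> t \<le> T \<Longrightarrow> iter k t x \<le> M * jb x powr a"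
proof -
  obtain B where B: "0 < B" and opB:
    "\<And>\<phi> C (x::'a). 0 \<le> C \<Longrightarrow> integrable lborel (\<lambda>y. besselB (x - y) * \<phi> y) \<Longrightarrow>
        (\<And>y. \<phi> y \<le> C * jb y powr a) \<Longrightarrow> besselOp \<phi> x \<le> B * C * jb x powr a"
    by (rule besselOp_le_weight[OF a_nonneg]) blast
  obtain L where L: "0 < L" and VL: "\<And>t x. 0 \<le> t \<Longrightarrow> t \<le> T \<Longrightarrow> V x t \<le> L * jb x powr \<sigma>"
    using Vupper[of T] by blast
  obtain C where C: "0 \<le> C" "\<And>x. u0 x \<le> C * jb x powr a" by (rule u0_bound) blast
  define G where "G = exp ((1 - p) * T)"
  \<comment> \<open>M \<ge> C dominates the initial value, and M \<ge> 1 permits replacing a p-th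
    power by the first power in the source bound.\<close>
  define M where "M = C + 1"
  \<comment> \<open>The sum of the growth rates of the linear term and of the source on
    {0..T}.\<close>
  define \<rho> where "\<rho> = B + G * (B * L)"
  have G: "0 < G" by (simp add: G_def)
  have \<rho>: "0 < \<rho>" using B G L by (simp add: \<rho>_def add_pos_pos)
  have M: "1 \<le> M" "C \<le> M" using C by (auto simp: M_def)
  have bound: "iter k t x \<le> M * exp (\<rho> * t) * jb x powr a" if "0 \<le> t" "t \<le> T" for k t x
    using that
  proof (induction k arbitrary: t x)
    case 0
    then show ?case using M by (simp add: iter_0)
  next
    case (Suc k)
    have "integral {0..t} (\<lambda>s. rhs (iter k) s x) \<le> \<rho> * M * jb x powr a * ((exp (\<rho> * t) - 1) / \<rho>)"
    proof (rule integral_le[OF rhs_integrable[OF iter_adm iter_continuous_time], THEN order_trans])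
      let ?g = "\<lambda>s. \<rho> * M * jb x powr a * exp (\<rho> * s)"
      have g: "(?g has_integral \<rho> * M * jb x powr a * ((exp (\<rho> * t) - 1) / \<rho>)) {0..t}"
        using Suc.prems \<rho> by (intro has_integral_mult_right has_integral_exp_real) auto
      then show "?g integrable_on {0..t}" by blast
      show "integral {0..t} ?g \<le> \<rho> * M * jb x powr a * ((exp (\<rho> * t) - 1) / \<rho>)"
        unfolding integral_unique[OF g] ..
      fix s assume "s \<in> {0..t}"
      then have s: "0 \<le> s" "s \<le> T" using Suc.prems by auto
      let ?N = "M * exp (\<rho> * s)"
      have N: "1 \<le> ?N" using M s \<rho> mult_mono[of 1 M 1 "exp (\<rho> * s)"] by simp
      have "besselOp (iter k s) x \<le> B * ?N * jb x powr a"
        using s N Suc.IH[OF s] by (intro opB adm_integrable iter_adm) auto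
      moreover have "exp ((1 - p) * s) * besselOp (source (iter k) s) x \<le> G * (B * (L * ?N) * jb x powr a)"
      proof (intro mult_mono)
        show "exp ((1 - p) * s) \<le> G" unfolding G_def using s p by simp
        show "besselOp (source (iter k) s) x \<le> B * (L * ?N) * jb x powr a"
        proof (intro opB adm_integrable(2)[OF iter_adm] s)
          show "source (iter k) s y \<le> L * ?N * jb y powr a" for y
          proof -
            have "source (iter k) s y \<le> L * ?N powr p * jb y powr a"
              using s N L VL[OF s] Suc.IH[OF s] adm_nonneg[OF iter_adm s(1)] by (intro source_le) auto
            also have "\<dots> \<le> L * ?N powr 1 * jb y powr a"
              using N p L by (intro mult_right_mono mult_left_mono powr_mono) auto
            finally show ?thesis using N by simp
          qed
        qed (use L N in auto)
      qed (use s G in \<open>auto intro: besselOp_nonneg source_nonneg\<close>)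
      ultimately show "rhs (iter k) s x \<le> ?g s"
        unfolding rhs_def \<rho>_def by (simp add: algebra_simps)
    qed
    \<comment> \<open>The subtracted term is exactly the room needed for u0.\<close>
    also have "\<dots> = M * exp (\<rho> * t) * jb x powr a - M * jb x powr a"
      using \<rho> by (simp add: field_simps)
    finally have "integral {0..t} (\<lambda>s. rhs (iter k) s x) \<le> M * exp (\<rho> * t) * jb x powr a - M * jb x powr a" .
    moreover have "u0 x \<le> M * jb x powr a"
      by (intro order_trans[OF C(2) mult_right_mono[OF M(2)]]) simp
    ultimately show ?case unfolding iter_Suc picard_def by simp
  qed
  show ?thesis
  proof
    show "0 \<le> M * exp (\<rho> * T)" using M by simp
    fix k t x assume t: "0 \<le> t" "t \<le> T"
    have "iter k t x \<le> M * exp (\<rho> * t) * jb x powr a" using t by (rule bound)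
    also have "\<dots> \<le> M * exp (\<rho> * T) * jb x powr a"
      using t \<rho> M by (intro mult_right_mono mult_left_mono) auto
    finally show "iter k t x \<le> M * exp (\<rho> * T) * jb x powr a" .
  qed
qed

section \<open>The limit of the iterates is a solution\<close>

definition min_sol :: "real \<Rightarrow> 'a \<Rightarrow> real" where
  "min_sol t x = lim (\<lambda>k. iter k t x)"

lemma iter_tendsto:
  assumes "0 \<le> t"
  shows "(\<lambda>k. iter k t x) \<longlonglongrightarrow> min_sol t x"
proof -
  obtain M where M: "\<And>k s x. 0 \<le> s \<Longrightarrow> s \<le> t \<Longrightarrow> iter k s x \<le> M * jb x powr a"
    by (rule iter_bound[OF assms]) blast
  have "incseq (\<lambda>k. iter k t x)" using assms by (intro incseq_SucI iter_mono)
  moreover have "\<forall>k. iter k t x \<le> M * jb x powr a" using M[of t] assms by auto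
  ultimately have "convergent (\<lambda>k. iter k t x)"
    by (metis incseq_convergent convergent_def)
  then show ?thesis unfolding min_sol_def by (simp add: convergent_LIMSEQ_iff)
qed

lemma min_sol_adm: "adm min_sol"
  unfolding adm_def
proof (intro conjI allI impI)
  fix t :: real assume t: "0 \<le> t"
  show "min_sol t \<in> borel_measurable borel"
    using t by (intro borel_measurable_LIMSEQ_real[OF iter_tendsto]) (auto intro: adm_measurable iter_adm)
  show "0 \<le> min_sol t x" for x
    using t by (intro LIMSEQ_le_const[OF iter_tendsto]) (auto intro: adm_nonneg[OF iter_adm])
next
  fix T
  show "\<exists>M\<ge>0. \<forall>t x. 0 \<le> t \<and> t \<le> T \<longrightarrow> min_sol t x \<le> M * jb x powr a"
  proof (cases "0 \<le> T")
    case True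
    obtain M where M: "0 \<le> M" "\<And>k s x. 0 \<le> s \<Longrightarrow> s \<le> T \<Longrightarrow> iter k s x \<le> M * jb x powr a"
      by (rule iter_bound[OF True]) blast
    then show ?thesis
      by (intro exI[of _ M]) (auto intro!: LIMSEQ_le_const2[OF iter_tendsto])
  qed auto
qed

text \<open>Dominated convergence twice, in y inside the Bessel potential and then in time, with
  bounds uniform in k. Time integrability of the limit is part of the second application, since its
  continuity in time is not yet known.\<close>

lemma min_sol_equation:
  assumes t: "0 \<le> t"
  shows "(\<lambda>s. besselOp (min_sol s) x) integrable_on {0..t}"
    and "(\<lambda>s. exp ((1 - p) * s) * besselOp (source min_sol s) x) integrable_on {0..t}"
    and "min_sol t x = u0 x + integral {0..t} (\<lambda>s. besselOp (min_sol s) x)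
        + integral {0..t} (\<lambda>s. exp ((1 - p) * s) * besselOp (source min_sol s) x)"
proof -
  obtain B where B: "0 < B" and opB:
    "\<And>\<phi> C (x::'a). 0 \<le> C \<Longrightarrow> integrable lborel (\<lambda>y. besselB (x - y) * \<phi> y) \<Longrightarrow>
        (\<And>y. \<phi> y \<le> C * jb y powr a) \<Longrightarrow> besselOp \<phi> x \<le> B * C * jb x powr a"
    by (rule besselOp_le_weight[OF a_nonneg]) blast
  obtain L where L: "0 < L" and VL: "\<And>s x. 0 \<le> s \<Longrightarrow> s \<le> t \<Longrightarrow> V x s \<le> L * jb x powr \<sigma>"
    using Vupper[of t] by blast
  obtain M where M: "0 \<le> M" "\<And>k s x. 0 \<le> s \<Longrightarrow> s \<le> t \<Longrightarrow> iter k s x \<le> M * jb x powr a"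
    by (rule iter_bound[OF t]) blast
  define N where "N = L * M powr p"
  have N: "0 \<le> N" using L by (simp add: N_def)
  have src: "source (iter k) s y \<le> N * jb y powr a" if "0 \<le> s" "s \<le> t" for k s y
    unfolding N_def using that VL M L adm_nonneg[OF iter_adm] by (intro source_le) auto
  have lim: "(\<lambda>k. besselOp (iter k s) x) \<longlonglongrightarrow> besselOp (min_sol s) x" if s: "0 \<le> s" "s \<le> t" for s
    using s M adm_nonneg[OF iter_adm s(1)] iter_adm min_sol_adm
    by (intro tendsto_besselOp[OF a_nonneg, where C = M] iter_tendsto adm_measurable) auto
  have lim_src: "(\<lambda>k. besselOp (source (iter k) s) x) \<longlonglongrightarrow> besselOp (source min_sol s) x"
    if s: "0 \<le> s" "s \<le> t" for s
  proof (rule tendsto_besselOp[OF a_nonneg, where C = N])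
    show "\<bar>source (iter k) s y\<bar> \<le> N * jb y powr a" for k y
      using src[OF s] source_nonneg[OF s(1)] by simp
    show "(\<lambda>k. source (iter k) s y) \<longlonglongrightarrow> source min_sol s y" for y
      unfolding source_def using p s adm_nonneg[OF iter_adm s(1)]
      by (intro tendsto_mult tendsto_const tendsto_powr' iter_tendsto) auto
  qed (use s in \<open>auto intro: source_measurable iter_adm min_sol_adm\<close>)
  note cont = besselOp_continuous_time[OF iter_adm iter_continuous_time]
  have int1: "(\<lambda>s. besselOp (iter k s) x) integrable_on {0..t}"
    and int2: "(\<lambda>s. exp ((1 - p) * s) * besselOp (source (iter k) s) x) integrable_on {0..t}" for k
    by (intro integrable_continuous_real continuous_intros cont)+
  have le1: "norm (besselOp (iter k s) x) \<le> B * M * jb x powr a" if s: "s \<in> {0..t}" for k s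
  proof -
    have "besselOp (iter k s) x \<le> B * M * jb x powr a"
      using s M by (intro opB adm_integrable iter_adm) auto
    moreover have "0 \<le> besselOp (iter k s) x"
      using s by (intro besselOp_nonneg adm_nonneg[OF iter_adm]) auto
    ultimately show ?thesis by simp
  qed
  have le2: "norm (exp ((1 - p) * s) * besselOp (source (iter k) s) x)
      \<le> exp ((1 - p) * t) * (B * N * jb x powr a)" if s: "s \<in> {0..t}" for k s
  proof -
    have "besselOp (source (iter k) s) x \<le> B * N * jb x powr a"
      using s src N by (intro opB adm_integrable iter_adm) auto
    moreover have nn: "0 \<le> besselOp (source (iter k) s) x"
      using s by (intro besselOp_nonneg source_nonneg) auto
    moreover have "exp ((1 - p) * s) \<le> exp ((1 - p) * t)" using s p by simp
    ultimately have "exp ((1 - p) * s) * besselOp (source (iter k) s) x \<le> exp ((1 - p) * t) * (B * N * jb x powr a)"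
      by (intro mult_mono) auto
    then show ?thesis using nn by simp
  qed
  have conv1: "(\<lambda>s. besselOp (min_sol s) x) integrable_on {0..t}"
    "(\<lambda>k. integral {0..t} (\<lambda>s. besselOp (iter k s) x)) \<longlonglongrightarrow> integral {0..t} (\<lambda>s. besselOp (min_sol s) x)"
    using lim by (auto intro!: dominated_convergence[OF int1 integrable_const_ivl le1])
  have conv2: "(\<lambda>s. exp ((1 - p) * s) * besselOp (source min_sol s) x) integrable_on {0..t}"
    "(\<lambda>k. integral {0..t} (\<lambda>s. exp ((1 - p) * s) * besselOp (source (iter k) s) x))
      \<longlonglongrightarrow> integral {0..t} (\<lambda>s. exp ((1 - p) * s) * besselOp (source min_sol s) x)"
    using lim_src by (auto intro!: dominated_convergence[OF int2 integrable_const_ivl le2] tendsto_mult)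
  show "(\<lambda>s. besselOp (min_sol s) x) integrable_on {0..t}"
    "(\<lambda>s. exp ((1 - p) * s) * besselOp (source min_sol s) x) integrable_on {0..t}"
    by (fact conv1(1), fact conv2(1))
  have "iter (Suc k) t x = u0 x + integral {0..t} (\<lambda>s. besselOp (iter k s) x)
      + integral {0..t} (\<lambda>s. exp ((1 - p) * s) * besselOp (source (iter k) s) x)" for k
    unfolding iter_Suc picard_def rhs_def
    by (subst Henstock_Kurzweil_Integration.integral_add[OF int1 int2]) simp
  then have "(\<lambda>k. iter (Suc k) t x) \<longlonglongrightarrow> u0 x + integral {0..t} (\<lambda>s. besselOp (min_sol s) x)
        + integral {0..t} (\<lambda>s. exp ((1 - p) * s) * besselOp (source min_sol s) x)"
    by (simp only:) (intro tendsto_add tendsto_const conv1 conv2)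
  then show "min_sol t x = u0 x + integral {0..t} (\<lambda>s. besselOp (min_sol s) x)
        + integral {0..t} (\<lambda>s. exp ((1 - p) * s) * besselOp (source min_sol s) x)"
    using LIMSEQ_unique LIMSEQ_Suc[OF iter_tendsto[OF t]] by blast
qed

lemma min_sol_rhs:
  assumes t: "0 \<le> t"
  shows "(\<lambda>s. rhs min_sol s x) integrable_on {0..t}"
    and "min_sol t x = u0 x + integral {0..t} (\<lambda>s. rhs min_sol s x)"
  unfolding rhs_def using min_sol_equation[OF t, of x]
  by (auto intro: Henstock_Kurzweil_Integration.integrable_add simp: Henstock_Kurzweil_Integration.integral_add)

lemma min_sol_BC:
  assumes t: "0 \<le> t"
  shows "min_sol t \<in> BC a"
proof -
  obtain C where C: "\<And>s x. 0 \<le> s \<Longrightarrow> s \<le> t \<Longrightarrow> min_sol s x \<le> C * jb x powr a"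
    by (rule adm_bounds[OF min_sol_adm, of t]) blast
  have "continuous_on UNIV (\<lambda>x. u0 x + integral {0..t} (\<lambda>s. rhs min_sol s x))"
    by (intro continuous_intros u0_continuous integral_rhs_continuous_space min_sol_adm min_sol_rhs t)
  then have "continuous_on UNIV (min_sol t)"
    by (subst continuous_on_cong[OF refl min_sol_rhs(2)[OF t]])
  then show ?thesis
    using C[of t] t adm_nonneg[OF min_sol_adm t] by (intro BC_I[of _ a C] a_nonneg) auto
qed

text \<open>On {0..T} the integrand of the equation is bounded by a multiple of the weight, so its
  primitive is Lipschitz in time in the weighted norm; this yields membership in
  \<open>Zinf\<close>.\<close>

lemma min_sol_Lipschitz:
  obtains L where "0 \<le> L"
    "\<And>s t x. s \<in> {0..T} \<Longrightarrow> t \<in> {0..T} \<Longrightarrow> \<bar>min_sol s x - min_sol t x\<bar> \<le> L * \<bar>s - t\<bar> * jb x powr a"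
proof -
  obtain C where C: "0 \<le> C" "\<And>s x. 0 \<le> s \<Longrightarrow> s \<le> T \<Longrightarrow> \<bar>rhs min_sol s x\<bar> \<le> C * jb x powr a"
    by (rule adm_rhs_bound[OF min_sol_adm, of T]) blast
  have le: "\<bar>min_sol t x - min_sol s x\<bar> \<le> C * (t - s) * jb x powr a"
    if st: "0 \<le> s" "s \<le> t" "t \<le> T" for s t x
  proof -
    have t: "0 \<le> t" using st by simp
    have int: "(\<lambda>r. rhs min_sol r x) integrable_on {s..t}"
      using st by (intro integrable_on_subinterval[OF min_sol_rhs(1)[OF t]]) auto
    have "integral {0..s} (\<lambda>r. rhs min_sol r x) + integral {s..t} (\<lambda>r. rhs min_sol r x)
        = integral {0..t} (\<lambda>r. rhs min_sol r x)"
      using st by (intro Henstock_Kurzweil_Integration.integral_combine min_sol_rhs) auto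
    then have "min_sol t x - min_sol s x = integral {s..t} (\<lambda>r. rhs min_sol r x)"
      using min_sol_rhs(2)[OF t, of x] min_sol_rhs(2)[OF st(1), of x] by simp
    moreover have "norm (integral {s..t} (\<lambda>r. rhs min_sol r x)) \<le> C * jb x powr a * (t - s)"
      using has_integral_bound_real[OF _ finite.emptyI integrable_integral[OF int], of "C * jb x powr a"] C st by auto
    ultimately show ?thesis by (simp add: mult_ac)
  qed
  have "\<bar>min_sol s x - min_sol t x\<bar> \<le> C * \<bar>s - t\<bar> * jb x powr a"
    if "s \<in> {0..T}" "t \<in> {0..T}" for s t x
    using le[of s t x] le[of t s x] that by (cases "s \<le> t") (auto simp: abs_minus_commute)
  then show ?thesis by (rule that[OF C(1)])
qed

lemma min_sol_sol: "sol min_sol"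
  unfolding sol_def
proof (intro conjI allI impI)
  show "min_sol \<in> Zinf a"
  proof (rule Zinf_I[OF min_sol_BC])
    fix T :: real
    obtain L where "\<And>s t x. s \<in> {0..T} \<Longrightarrow> t \<in> {0..T} \<Longrightarrow> \<bar>min_sol s x - min_sol t x\<bar> \<le> L * \<bar>s - t\<bar> * jb x powr a"
      by (rule min_sol_Lipschitz[of T]) blast
    then show "\<exists>L. \<forall>s\<in>{0..T}. \<forall>t\<in>{0..T}. \<forall>x. \<bar>min_sol s x - min_sol t x\<bar> \<le> L * \<bar>s - t\<bar> * jb x powr a"
      by blast
  qed
qed (auto intro: adm_nonneg[OF min_sol_adm] adm_integrable[OF min_sol_adm] min_sol_equation)

text \<open>The existence claim asks that u itself, and not only exp(t) u, lie in
  \<open>Zinf\<close>. Multiplication by exp(-t), bounded by 1 and Lipschitz with constant 1 for t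
  \<ge> 0, preserves the weighted Lipschitz bound.\<close>

lemma exp_minus_min_sol_Zinf: "(\<lambda>t x. exp (- t) * min_sol t x) \<in> Zinf a"
proof (rule Zinf_I)
  fix t :: real assume t: "0 \<le> t"
  obtain C where C: "\<And>x. \<bar>min_sol t x\<bar> \<le> C * jb x powr a"
    by (rule BC_bound[OF min_sol_BC[OF t] a_nonneg]) blast
  have "continuous_on UNIV (min_sol t)" using min_sol_BC[OF t] by (simp add: BC_def)
  then show "(\<lambda>x. exp (- t) * min_sol t x) \<in> BC a"
  proof (intro BC_I a_nonneg continuous_intros)
    show "\<bar>exp (- t) * min_sol t x\<bar> \<le> (exp (- t) * C) * jb x powr a" for x
      using C[of x] by (simp add: abs_mult mult.assoc)
  qed
next
  fix T :: real
  obtain L where L: "0 \<le> L"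
    "\<And>s t x. s \<in> {0..T} \<Longrightarrow> t \<in> {0..T} \<Longrightarrow> \<bar>min_sol s x - min_sol t x\<bar> \<le> L * \<bar>s - t\<bar> * jb x powr a"
    by (rule min_sol_Lipschitz[of T]) blast
  obtain C where C: "0 \<le> C" "\<And>s x. 0 \<le> s \<Longrightarrow> s \<le> T \<Longrightarrow> min_sol s x \<le> C * jb x powr a"
    by (rule adm_bounds[OF min_sol_adm, of T]) blast
  have exp_Lip: "\<bar>exp (- s) - exp (- t)\<bar> \<le> \<bar>s - t\<bar>" if "0 \<le> s" "0 \<le> t" for s t :: real
  proof -
    have le: "exp (- s) - exp (- t) \<le> t - s" if "0 \<le> s" "s \<le> t" for s t :: real
    proof -
      have "exp (- s) - exp (- t) = exp (- s) * (1 - exp (- (t - s)))"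
        by (simp add: algebra_simps flip: exp_add)
      also have "\<dots> \<le> 1 * (t - s)"
        using that exp_ge_add_one_self[of "s - t"] by (intro mult_mono) (auto simp del: exp_ge_add_one_self)
      finally show ?thesis by simp
    qed
    show ?thesis using le[of s t] le[of t s] that by (cases "s \<le> t") auto
  qed
  have "\<bar>exp (- s) * min_sol s x - exp (- t) * min_sol t x\<bar> \<le> (L + C) * \<bar>s - t\<bar> * jb x powr a"
    if st: "s \<in> {0..T}" "t \<in> {0..T}" for s t x
  proof -
    have "exp (- s) * min_sol s x - exp (- t) * min_sol t x
        = exp (- s) * (min_sol s x - min_sol t x) + (exp (- s) - exp (- t)) * min_sol t x"
      by (simp add: algebra_simps)
    then have "\<bar>exp (- s) * min_sol s x - exp (- t) * min_sol t x\<bar>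
        \<le> exp (- s) * \<bar>min_sol s x - min_sol t x\<bar> + \<bar>exp (- s) - exp (- t)\<bar> * \<bar>min_sol t x\<bar>"
      by (simp add: abs_mult order_trans[OF abs_triangle_ineq])
    also have "\<dots> \<le> 1 * (L * \<bar>s - t\<bar> * jb x powr a) + \<bar>s - t\<bar> * (C * jb x powr a)"
      using st L C(2)[of t x] adm_nonneg[OF min_sol_adm, of t x]
      by (intro add_mono mult_mono exp_Lip) auto
    finally show ?thesis by (simp add: algebra_simps)
  qed
  then show "\<exists>L. \<forall>s\<in>{0..T}. \<forall>t\<in>{0..T}. \<forall>x.
      \<bar>exp (- s) * min_sol s x - exp (- t) * min_sol t x\<bar> \<le> L * \<bar>s - t\<bar> * jb x powr a"
    by blast
qed

theorem unique_global_solution: "unique_nonneg_global_s_solution V p a u0"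
  unfolding unique_nonneg_global_s_solution_def
proof (intro exI conjI allI impI)
  let ?u = "\<lambda>t x. exp (- t) * min_sol t x"
  have "sol (\<lambda>t x. exp t * ?u t x)"
    using min_sol_sol by (simp flip: mult.assoc exp_add)
  then show "s_solution V p a u0 ?u" "\<And>t x. 0 \<le> t \<Longrightarrow> 0 \<le> ?u t x"
    unfolding s_solution_iff_sol[symmetric] by auto
  show "?u \<in> Zinf a" by (rule exp_minus_min_sol_Zinf)
  fix v t x assume v: "s_solution V p a u0 v \<and> (\<forall>t\<ge>0. \<forall>x. 0 \<le> v t x)" and t: "0 \<le> (t::real)"
  have "exp t * v t x = min_sol t x"
    using sol_unique[OF v[unfolded s_solution_iff_sol] min_sol_sol t] .
  then show "v t x = exp (- t) * min_sol t x"
    by (simp add: exp_minus field_simps)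
qed

end

section \<open>Reduction of the stated problem to two-sided bounds on V\<close>

theorem mainTheorem5:
  fixes V :: "'a::euclidean_space \<Rightarrow> real \<Rightarrow> real"
    and \<Lambda> :: "real \<Rightarrow> real"
    and u0 :: "'a \<Rightarrow> real"
    and p \<sigma> \<theta>lo \<theta>hi a :: real
  assumes p: "0 < p" "p < 1"
    and sigma: "\<sigma> \<in> Jplus DIM('a)"
    and Lambda: "continuous_on {0..} \<Lambda>" "\<forall>t\<ge>0. \<Lambda> t > 0"
    and theta: "\<theta>lo > 0" "\<theta>hi > 0"
    and Vcont: "continuous_on (UNIV \<times> {0..}) (\<lambda>(x, t). V x t)"
    and Vnonneg: "\<forall>x. \<forall>t\<ge>0. V x t \<ge> 0"
    and Vlow: "\<forall>x t. norm x \<ge> 1 \<and> t > 0 \<longrightarrow> V x t \<ge> \<theta>lo * \<Lambda> t * pw (norm x) \<sigma>"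
    and Vup: "\<forall>x t. t > 0 \<longrightarrow> V x t \<le> \<theta>hi * \<Lambda> t * pw (norm x) \<sigma>"
    and a: "a \<ge> \<sigma> / (1 - p)"
    and u0: "u0 \<in> BC a" "\<forall>x. u0 x \<ge> 0" "\<exists>x. u0 x \<noteq> 0"
  shows "(\<forall>\<epsilon>0>0.
            (\<forall>x::'a. \<forall>d. 0 \<le> d \<and> d \<le> \<sigma> * p / (1 - p) \<longrightarrow>
               (\<integral>y\<in>{y. norm (x - y) \<ge> 1}. besselB y * pw (norm (x - y)) (\<sigma> + d) \<partial>lborel)
                 \<ge> \<epsilon>0 * pw (norm x) (\<sigma> + d)) \<longrightarrow>
            p < \<epsilon>0 * \<theta>lo / \<theta>hi \<longrightarrow>
            unique_nonneg_global_s_solution V p a u0)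
       \<and> ((\<forall>x t. V x t = \<Lambda> t * pw (norm x) \<sigma>) \<longrightarrow>
            unique_nonneg_global_s_solution V p a u0)"
proof -
  have \<sigma>: "0 \<le> \<sigma>" using sigma by (auto simp: Jplus_def split: if_splits)
  \<comment> \<open>The extreme values of \<Lambda> on the compact interval; for negative T the
    claim is vacuous and 1 is a placeholder.\<close>
  have bounds: "\<exists>l h. 0 < l \<and> 0 < h \<and> (\<forall>t. 0 \<le> t \<and> t \<le> T \<longrightarrow> l \<le> \<Lambda> t \<and> \<Lambda> t \<le> h)" for T
  proof (cases "0 \<le> T")
    case True
    have cont: "continuous_on {0..T} \<Lambda>" using Lambda(1) by (rule continuous_on_subset) auto
    obtain s where s: "s \<in> {0..T}" "\<And>t. t \<in> {0..T} \<Longrightarrow> \<Lambda> s \<le> \<Lambda> t"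
      using continuous_attains_inf[OF compact_Icc _ cont] True by auto
    obtain r where r: "r \<in> {0..T}" "\<And>t. t \<in> {0..T} \<Longrightarrow> \<Lambda> t \<le> \<Lambda> r"
      using continuous_attains_sup[OF compact_Icc _ cont] True by auto
    show ?thesis using s r Lambda(2) by (intro exI[of _ "\<Lambda> s"] exI[of _ "\<Lambda> r"]) auto
  qed (auto intro!: exI[of _ 1])
  interpret sublinear_problem V p \<sigma> a u0
  proof
    show "\<exists>L>0. \<forall>t x. 0 \<le> t \<and> t \<le> T \<longrightarrow> V x t \<le> L * jb x powr \<sigma>" for T
    proof -
      \<comment> \<open>The upper bound on V is given for t > 0 only, and the value at t = 0 is
        reached as a limit from the right. Enlarging T to at least 1 provides positive times for
        that limit.\<close>
      obtain h where h: "0 < h" "\<And>t. 0 \<le> t \<Longrightarrow> t \<le> max T 1 \<Longrightarrow> \<Lambda> t \<le> h"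
        using bounds[of "max T 1"] by blast
      have pos: "V x t \<le> \<theta>hi * h * jb x powr \<sigma>" if "0 < t" "t \<le> max T 1" for x t
      proof -
        have "V x t \<le> \<theta>hi * \<Lambda> t * pw (norm x) \<sigma>" using Vup that by blast
        also have "\<dots> \<le> \<theta>hi * h * jb x powr \<sigma>"
          using h(2)[of t] that theta h(1) Lambda(2)
          by (intro mult_mono pw_norm_le_jb \<sigma>) (auto simp: pw_def less_imp_le)
        finally show ?thesis .
      qed
      have "V x 0 \<le> \<theta>hi * h * jb x powr \<sigma>" for x
      proof (rule tendsto_upperbound)
        have "continuous_on {0..} (\<lambda>t. V x t)"
        proof -
          have "continuous_on {0..} (\<lambda>t. case (x, t) of (x, t) \<Rightarrow> V x t)"
            by (intro continuous_on_compose2[OF Vcont]) (auto intro!: continuous_intros)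
          then show ?thesis by simp
        qed
        then have "(V x \<longlongrightarrow> V x 0) (at 0 within {0..})" by (auto simp: continuous_on_def)
        then show "(V x \<longlongrightarrow> V x 0) (at_right 0)" by (rule tendsto_within_subset) auto
        show "\<forall>\<^sub>F t in at_right 0. V x t \<le> \<theta>hi * h * jb x powr \<sigma>"
          unfolding eventually_at_right_field by (intro exI[of _ 1]) (auto intro!: pos)
      qed auto
      then have "\<forall>t x. 0 \<le> t \<and> t \<le> T \<longrightarrow> V x t \<le> \<theta>hi * h * jb x powr \<sigma>"
        using pos by (metis max.coboundedI1 order_le_less)
      then show ?thesis using h theta by (intro exI[of _ "\<theta>hi * h"]) auto
    qed
    show "\<exists>l>0. \<forall>t x. 0 < t \<and> t \<le> T \<and> 1 \<le> norm x \<longrightarrow> l * norm x powr \<sigma> \<le> V x t" for T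
    proof -
      obtain l where l: "0 < l" "\<And>t. 0 \<le> t \<Longrightarrow> t \<le> T \<Longrightarrow> l \<le> \<Lambda> t"
        using bounds[of T] by blast
      have "\<theta>lo * l * norm x powr \<sigma> \<le> V x t" if "0 < t" "t \<le> T" "1 \<le> norm x" for t and x :: 'a
      proof -
        have "\<theta>lo * l * norm x powr \<sigma> \<le> \<theta>lo * \<Lambda> t * pw (norm x) \<sigma>"
          using that theta l Lambda(2) by (intro mult_mono) (auto simp: pw_def less_imp_le)
        also have "\<dots> \<le> V x t" using Vlow that by blast
        finally show ?thesis .
      qed
      then show ?thesis using l theta by (intro exI[of _ "\<theta>lo * l"]) auto
    qed
  qed (use p \<sigma> a Vcont Vnonneg u0 in auto)
  show ?thesis using unique_global_solution by blast
qed

end
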